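(* Let $\mathcal V$ be a commutative quantale. Every functor $H:\mathsf{Set}\to\mathcal V\text{-}\mathsf{cat}$ has a $\mathcal V\text{-}\mathsf{cat}$-enriched left Kan extension $H^\sharp:\mathcal V\text{-}\mathsf{cat}\to\mathcal V\text{-}\mathsf{cat}$ along the discrete functor $D:\mathsf{Set}\to\mathcal V\text{-}\mathsf{cat}$, given on objects by the weighted colimit $H^\sharp\mathcal X=N*(HF_{\mathcal X})$.
   Context: $\mathcal V=(\mathcal V_o,\otimes,e,[-,-])$ is a commutative quantale: a complete lattice with a commutative, associative, monotone operation $\otimes$ with unit $e$, such that each $-\otimes r$ has a right adjoint $[r,-]$; $\mathcal V$ is assumed non-trivial ($e\neq\bot$). A (small) $\mathcal V$-category $\mathcal X$ is a set of objects together with elements $\mathcal X(x',x)\in\mathcal V_o$ satisfying $e\le\mathcal X(x,x)$ and $\mathcal X(x',x)\otimes\mathcal X(x'',x')\le\mathcal X(x'',x)$; a $\mathcal V$-functor $f:\mathcal X\to\mathcal Y$ is a map on objects with $\mathcal X(x',x)\le\mathcal Y(fx',fx)$. $\mathcal V\text{-}\mathsf{cat}$ is the symmetric monoidal closed category of small $\mathcal V$-categories and $\mathcal V$-functors, with $(\mathcal X\otimes\mathcal Y)((x',y'),(x,y))=\mathcal X(x',x)\otimes\mathcal Y(y',y)$, unit $\mathbb 1$ (one object $0$ with $\mathbb 1(0,0)=e$), and internal hom $[\mathcal Y,\mathcal Z]=\mathcal V\text{-}\mathsf{cat}(\mathcal Y,\mathcal Z)$ of $\mathcal V$-functors with $[\mathcal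 Y,\mathcal Z](f,g)=\bigwedge_y\mathcal Z(fy,gy)$; it is enriched over itself. $\mathsf{Set}$ is regarded as a $\mathcal V\text{-}\mathsf{cat}$-category whose homs are the discrete $\mathcal V$-categories (distance $e$ between equal objects, $\bot$ otherwise) on the sets of functions, so ordinary functors out of $\mathsf{Set}$ are automatically $\mathcal V\text{-}\mathsf{cat}$-functors; $D:\mathsf{Set}\to\mathcal V\text{-}\mathsf{cat}$ sends a set to the discrete $\mathcal V$-category on it. For a $\mathcal V\text{-}\mathsf{cat}$-functor $F:\mathbb A\to\mathbb X$ and a weight $W:\mathbb A^{op}\to\mathcal V\text{-}\mathsf{cat}$, the weighted colimit $W*F$ is an object of $\mathbb X$ with an isomorphism $\mathbb X(W*F,X)\cong[\mathbb A^{op},\mathcal V\text{-}\mathsf{cat}](W,\mathbb X(F-,X))$ in $\mathcal V\text{-}\mathsf{cat}$, natural in $X$. An enriched left Kan extension of $H:\mathbb A\to\mathbb X$ along $J:\mathbb A\to\mathbb B$ is a $\mathcal V\text{-}\mathsf{cat}$-functor $\mathrm{Lan}_JH:\mathbb B\to\mathbb X$ with a $\mathcal V\text{-}\mathsf{cat}$-natural isomorphism $(\mathrm{Lan}_JH)B\cong\mathbb B(J-,B)*H$; for $\mathbb X=\mathcal V\text{-}\mathsf{cat}$ this is equivalent to a bijection, natural in $H':\mathbb B\to\mathbb X$, between $\mathcal V\text{-}\mathsf{cat}$-natural transformations $\mathrm{Lan}_JH\to H'$ and $H\to H'J$. $\mathbb N$ is the free $\mathcal V\text{-}\mathsf{cat}$-category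 on the ordinary category with objects all $r\in\mathcal V_o$ and an extra object $\mathsf o$, and non-identity arrows $\delta^r_0,\delta^r_1:r\to\mathsf o$ for each $r\in\mathcal V_o$. $N:\mathbb N^{op}\to\mathcal V\text{-}\mathsf{cat}$ sends $\mathsf o$ to $\mathbb 1$ and $r$ to $\mathbb 2_r$, the $\mathcal V$-category with objects $0,1$ and $\mathbb 2_r(0,0)=\mathbb 2_r(1,1)=e$, $\mathbb 2_r(0,1)=r$, $\mathbb 2_r(1,0)=\bot$; $N\delta^r_i:\mathbb 1\to\mathbb 2_r$ picks the object $i$. For a $\mathcal V$-category $\mathcal X$, $F_{\mathcal X}:\mathbb N\to\mathsf{Set}$ sends $\mathsf o$ to the set $X_{\mathsf o}$ of objects of $\mathcal X$, $r$ to $X_r=\{(x',x)\mid r\le\mathcal X(x',x)\}$, and $\delta^r_0,\delta^r_1$ to the first and second projections. *)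

theory Defs
  imports Main "HOL-Library.FuncSet"
begin

section \<open>Commutative quantales\<close>

text \<open>The tensor is written \<open>*\<close>, its unit \<open>1\<close>, and \<open>residual r y\<close> is $[r,y]$.\<close>

class commutative_quantale = complete_lattice + comm_monoid_mult +
  fixes residual :: "'a \<Rightarrow> 'a \<Rightarrow> 'a"
  assumes tensor_mono: "x \<le> x' \<Longrightarrow> y \<le> y' \<Longrightarrow> x * y \<le> x' * y'"
    and residual_adjoint: "x * r \<le> y \<longleftrightarrow> x \<le> residual r y"

class nontrivial_commutative_quantale = commutative_quantale +
  assumes unit_neq_bot: "1 \<noteq> bot"


section \<open>V-categories and V-functors\<close>

text \<open>Distances are \<open>undefined\<close> off the carrier and V-functors are extensional functions, so that
  HOL equality of V-categories and of V-functors is the intended equality.\<close>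

record ('v, 'a) vcat =
  Obj :: "'a set"
  Dist :: "'a \<Rightarrow> 'a \<Rightarrow> 'v"

definition mk_vcat :: "'a set \<Rightarrow> ('a \<Rightarrow> 'a \<Rightarrow> 'v) \<Rightarrow> ('v, 'a) vcat" where
  "mk_vcat S d = \<lparr>Obj = S, Dist = (\<lambda>x y. if x \<in> S \<and> y \<in> S then d x y else undefined)\<rparr>"

definition V_category :: "('v::commutative_quantale, 'a) vcat \<Rightarrow> bool" where
  "V_category X \<longleftrightarrow>
     (\<forall>x\<in>Obj X. 1 \<le> Dist X x x) \<and>
     (\<forall>x\<in>Obj X. \<forall>x'\<in>Obj X. \<forall>x''\<in>Obj X. Dist X x' x * Dist X x'' x' \<le> Dist X x'' x) \<and>
     (\<forall>x y. x \<notin> Obj X \<or> y \<notin> Obj X \<longrightarrow> Dist X x y = undefined)"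

definition V_functors ::
    "('v::commutative_quantale, 'a) vcat \<Rightarrow> ('v, 'b) vcat \<Rightarrow> ('a \<Rightarrow> 'b) set" where
  "V_functors X Y =
     {f \<in> Obj X \<rightarrow>\<^sub>E Obj Y. \<forall>x'\<in>Obj X. \<forall>x\<in>Obj X. Dist X x' x \<le> Dist Y (f x') (f x)}"

definition V_iso ::
    "('v::commutative_quantale, 'a) vcat \<Rightarrow> ('v, 'b) vcat \<Rightarrow> ('a \<Rightarrow> 'b) \<Rightarrow> bool" where
  "V_iso X Y f \<longleftrightarrow> f \<in> V_functors X Y \<and>
     (\<exists>g\<in>V_functors Y X. (\<forall>x\<in>Obj X. g (f x) = x) \<and> (\<forall>y\<in>Obj Y. f (g y) = y))"

definition discrete :: "'a set \<Rightarrow> ('v::commutative_quantale, 'a) vcat" where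
  "discrete S = mk_vcat S (\<lambda>x y. if x = y then 1 else bot)"

definition tensor ::
    "('v::commutative_quantale, 'a) vcat \<Rightarrow> ('v, 'b) vcat \<Rightarrow> ('v, 'a \<times> 'b) vcat" where
  "tensor X Y = mk_vcat (Obj X \<times> Obj Y)
     (\<lambda>p q. Dist X (fst p) (fst q) * Dist Y (snd p) (snd q))"

definition internal_hom ::
    "('v::commutative_quantale, 'a) vcat \<Rightarrow> ('v, 'b) vcat \<Rightarrow> ('v, 'a \<Rightarrow> 'b) vcat" where
  "internal_hom Y Z = mk_vcat (V_functors Y Z) (\<lambda>f g. INF y\<in>Obj Y. Dist Z (f y) (g y))"


section \<open>Categories enriched in V-cat\<close>

text \<open>\<open>Comp A a b c g f\<close> is the composite of \<open>f : a \<rightarrow> b\<close> and \<open>g : b \<rightarrow> c\<close>. An identity, i.e. a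
  V-functor from the unit V-category to \<open>Hom A a a\<close>, is the same thing as an object of \<open>Hom A a a\<close>.\<close>

record ('o, 'm, 'v) ecat =
  Ob :: "'o set"
  Hom :: "'o \<Rightarrow> 'o \<Rightarrow> ('v, 'm) vcat"
  Id :: "'o \<Rightarrow> 'm"
  Comp :: "'o \<Rightarrow> 'o \<Rightarrow> 'o \<Rightarrow> 'm \<Rightarrow> 'm \<Rightarrow> 'm"

abbreviation Arr :: "('o, 'm, 'v) ecat \<Rightarrow> 'o \<Rightarrow> 'o \<Rightarrow> 'm set" where
  "Arr A a b \<equiv> Obj (Hom A a b)"

definition enriched_category :: "('o, 'm, 'v::commutative_quantale) ecat \<Rightarrow> bool" where
  "enriched_category A \<longleftrightarrow>
     (\<forall>a\<in>Ob A. \<forall>b\<in>Ob A. V_category (Hom A a b)) \<and>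
     (\<forall>a\<in>Ob A. Id A a \<in> Arr A a a) \<and>
     (\<forall>a\<in>Ob A. \<forall>b\<in>Ob A. \<forall>c\<in>Ob A.
        (\<lambda>p\<in>Arr A b c \<times> Arr A a b. Comp A a b c (fst p) (snd p))
          \<in> V_functors (tensor (Hom A b c) (Hom A a b)) (Hom A a c)) \<and>
     (\<forall>a\<in>Ob A. \<forall>b\<in>Ob A. \<forall>f\<in>Arr A a b.
        Comp A a a b f (Id A a) = f \<and> Comp A a b b (Id A b) f = f) \<and>
     (\<forall>a\<in>Ob A. \<forall>b\<in>Ob A. \<forall>c\<in>Ob A. \<forall>d\<in>Ob A.
        \<forall>f\<in>Arr A a b. \<forall>g\<in>Arr A b c. \<forall>h\<in>Arr A c d.
        Comp A a b d (Comp A b c d h g) f = Comp A a c d h (Comp A a b c g f))"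

definition op_cat :: "('o, 'm, 'v) ecat \<Rightarrow> ('o, 'm, 'v) ecat" where
  "op_cat A = \<lparr>Ob = Ob A, Hom = (\<lambda>a b. Hom A b a), Id = Id A,
     Comp = (\<lambda>a b c g f. Comp A c b a f g)\<rparr>"

record ('o, 'm, 'p, 'n) func =
  omap :: "'o \<Rightarrow> 'p"
  amap :: "'o \<Rightarrow> 'o \<Rightarrow> 'm \<Rightarrow> 'n"

text \<open>Functors between the underlying ordinary categories; the distances on the homs play no role.\<close>

definition ordinary_functor ::
    "('o, 'm, 'v) ecat \<Rightarrow> ('p, 'n, 'v) ecat \<Rightarrow> ('o, 'm, 'p, 'n) func \<Rightarrow> bool" where
  "ordinary_functor A B F \<longleftrightarrow>
     omap F \<in> Ob A \<rightarrow> Ob B \<and>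
     (\<forall>a\<in>Ob A. \<forall>b\<in>Ob A. amap F a b \<in> Arr A a b \<rightarrow>\<^sub>E Arr B (omap F a) (omap F b)) \<and>
     (\<forall>a\<in>Ob A. amap F a a (Id A a) = Id B (omap F a)) \<and>
     (\<forall>a\<in>Ob A. \<forall>b\<in>Ob A. \<forall>c\<in>Ob A. \<forall>f\<in>Arr A a b. \<forall>g\<in>Arr A b c.
        amap F a c (Comp A a b c g f) =
          Comp B (omap F a) (omap F b) (omap F c) (amap F b c g) (amap F a b f))"

definition enriched_functor ::
    "('o, 'm, 'v::commutative_quantale) ecat \<Rightarrow> ('p, 'n, 'v) ecat \<Rightarrow> ('o, 'm, 'p, 'n) func \<Rightarrow> bool"
  where
  "enriched_functor A B F \<longleftrightarrow>
     enriched_category A \<and> enriched_category B \<and> ordinary_functor A B F \<and>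
     (\<forall>a\<in>Ob A. \<forall>b\<in>Ob A.
        amap F a b \<in> V_functors (Hom A a b) (Hom B (omap F a) (omap F b)))"

text \<open>The composite \<open>G F\<close>; the source \<open>A\<close> of \<open>F\<close> only serves to restrict the action on arrows.\<close>

definition comp_func ::
    "('o, 'm, 'v) ecat \<Rightarrow> ('p, 'n, 'q, 'k) func \<Rightarrow> ('o, 'm, 'p, 'n) func \<Rightarrow> ('o, 'm, 'q, 'k) func"
  where
  "comp_func A G F = \<lparr>omap = (\<lambda>a. omap G (omap F a)),
     amap = (\<lambda>a b. \<lambda>f\<in>Arr A a b. amap G (omap F a) (omap F b) (amap F a b f))\<rparr>"

text \<open>A V-cat-natural isomorphism is an ordinary natural one, because the functor from V-cat to Set
  taking the set of objects is faithful.\<close>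

definition natural_iso ::
    "('o, 'm, 'v) ecat \<Rightarrow> ('p, 'n, 'v) ecat \<Rightarrow> ('o, 'm, 'p, 'n) func \<Rightarrow> ('o, 'm, 'p, 'n) func
      \<Rightarrow> ('o \<Rightarrow> 'n) \<Rightarrow> bool" where
  "natural_iso A B F G \<theta> \<longleftrightarrow>
     (\<forall>a\<in>Ob A. \<theta> a \<in> Arr B (omap F a) (omap G a) \<and>
        (\<exists>\<theta>'\<in>Arr B (omap G a) (omap F a).
           Comp B (omap F a) (omap G a) (omap F a) \<theta>' (\<theta> a) = Id B (omap F a) \<and>
           Comp B (omap G a) (omap F a) (omap G a) (\<theta> a) \<theta>' = Id B (omap G a))) \<and>
     (\<forall>a\<in>Ob A. \<forall>b\<in>Ob A. \<forall>f\<in>Arr A a b.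
        Comp B (omap F a) (omap F b) (omap G b) (\<theta> b) (amap F a b f) =
        Comp B (omap F a) (omap G a) (omap G b) (amap G a b f) (\<theta> a))"


section \<open>The categories V-cat and Set\<close>

text \<open>HOL has no type of all sets, so smallness is relative to a collection \<open>U\<close> of subsets of an
  arbitrary type which is closed under subsets and binary products, the latter coded by an injective
  pairing on that type. Every Grothendieck universe is of this kind, as is the collection of all
  subsets of any infinite type.\<close>

definition set_universe :: "'u set set \<Rightarrow> ('u \<times> 'u \<Rightarrow> 'u) \<Rightarrow> bool" where
  "set_universe U pair \<longleftrightarrow> inj pair \<and>
     (\<forall>S\<in>U. \<forall>T. T \<subseteq> S \<longrightarrow> T \<in> U) \<and>
     (\<forall>S\<in>U. \<forall>T\<in>U. pair ` (S \<times> T) \<in> U)"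

definition VCat ::
    "'u set set \<Rightarrow> (('v::commutative_quantale, 'u) vcat, 'u \<Rightarrow> 'u, 'v) ecat" where
  "VCat U = \<lparr>Ob = {X. V_category X \<and> Obj X \<in> U}, Hom = internal_hom,
     Id = (\<lambda>X. \<lambda>x\<in>Obj X. x), Comp = (\<lambda>X Y Z g f. compose (Obj X) g f)\<rparr>"

definition SetCat ::
    "'u set set \<Rightarrow> ('u set, 'u \<Rightarrow> 'u, 'v::commutative_quantale) ecat" where
  "SetCat U = \<lparr>Ob = U, Hom = (\<lambda>S T. discrete (S \<rightarrow>\<^sub>E T)),
     Id = (\<lambda>S. \<lambda>x\<in>S. x), Comp = (\<lambda>S T R g f. compose S g f)\<rparr>"

definition D_func ::
    "('u set, 'u \<Rightarrow> 'u, ('v::commutative_quantale, 'u) vcat, 'u \<Rightarrow> 'u) func" where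
  "D_func = \<lparr>omap = discrete, amap = (\<lambda>S T. \<lambda>f\<in>S \<rightarrow>\<^sub>E T. f)\<rparr>"


section \<open>Weighted colimits and left Kan extensions\<close>

text \<open>Weights take values in \<open>VCat UNIV\<close> over an arbitrary type: the representable weights below have
  functions as objects, which in general do not live in the type carrying a given universe.\<close>

text \<open>The weight $X(F-,Z)$ on the opposite of \<open>A\<close>; an arrow \<open>f : b \<rightarrow> a\<close> of \<open>A\<close> acts by precomposition
  with \<open>F f\<close>.\<close>

definition hom_weight ::
    "('o, 'm, 'v) ecat \<Rightarrow> ('p, 'n, 'v) ecat \<Rightarrow> ('o, 'm, 'p, 'n) func \<Rightarrow> 'p
      \<Rightarrow> ('o, 'm, ('v, 'n) vcat, 'n \<Rightarrow> 'n) func" where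
  "hom_weight A X F Z = \<lparr>omap = (\<lambda>a. Hom X (omap F a) Z),
     amap = (\<lambda>a b. \<lambda>f\<in>Arr A b a. \<lambda>h\<in>Arr X (omap F a) Z.
               Comp X (omap F b) (omap F a) Z h (amap F b a f))\<rparr>"

text \<open>The V-category $[A,\mbox{V-cat}](W,G)$ of natural transformations between V-cat-valued functors;
  its distance is that of the end of the $[Wa,Ga]$. The values of \<open>W\<close> and \<open>G\<close> may have
  different types of objects.\<close>

definition nat_hom ::
    "('o, 'm, 'v::commutative_quantale) ecat \<Rightarrow> ('o, 'm, ('v, 'w) vcat, 'w \<Rightarrow> 'w) func
      \<Rightarrow> ('o, 'm, ('v, 'n) vcat, 'n \<Rightarrow> 'n) func \<Rightarrow> ('v, 'o \<Rightarrow> 'w \<Rightarrow> 'n) vcat" where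
  "nat_hom A W G = mk_vcat
     {\<alpha> \<in> (\<Pi>\<^sub>E a\<in>Ob A. V_functors (omap W a) (omap G a)).
        \<forall>a\<in>Ob A. \<forall>b\<in>Ob A. \<forall>f\<in>Arr A a b.
          compose (Obj (omap W a)) (amap G a b f) (\<alpha> a) =
          compose (Obj (omap W a)) (\<alpha> b) (amap W a b f)}
     (\<lambda>\<alpha> \<beta>. INF a\<in>Ob A. Dist (internal_hom (omap W a) (omap G a)) (\<alpha> a) (\<beta> a))"

text \<open>\<open>colimit_iso A X W F C \<phi>\<close>: the \<open>\<phi> Z\<close> are isomorphisms from $X(C,Z)$ to
  $[A^{op},\mbox{V-cat}](W,X(F-,Z))$, natural in \<open>Z\<close>, i.e. they exhibit \<open>C\<close> as $W*F$.\<close>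

definition colimit_iso ::
    "('o, 'm, 'v::commutative_quantale) ecat \<Rightarrow> ('p, 'n, 'v) ecat
      \<Rightarrow> ('o, 'm, ('v, 'w) vcat, 'w \<Rightarrow> 'w) func \<Rightarrow> ('o, 'm, 'p, 'n) func \<Rightarrow> 'p
      \<Rightarrow> ('p \<Rightarrow> 'n \<Rightarrow> 'o \<Rightarrow> 'w \<Rightarrow> 'n) \<Rightarrow> bool" where
  "colimit_iso A X W F C \<phi> \<longleftrightarrow>
     enriched_functor A X F \<and> enriched_functor (op_cat A) (VCat UNIV) W \<and> C \<in> Ob X \<and>
     (\<forall>Z\<in>Ob X. V_iso (Hom X C Z) (nat_hom (op_cat A) W (hom_weight A X F Z)) (\<phi> Z)) \<and>
     (\<forall>Z\<in>Ob X. \<forall>Z'\<in>Ob X. \<forall>k\<in>Arr X Z Z'. \<forall>h\<in>Arr X C Z.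
        \<phi> Z' (Comp X C Z Z' k h) =
          (\<lambda>a\<in>Ob A. \<lambda>w\<in>Obj (omap W a). Comp X (omap F a) Z Z' k (\<phi> Z h a w)))"

definition weighted_colimit ::
    "('o, 'm, 'v::commutative_quantale) ecat \<Rightarrow> ('p, 'n, 'v) ecat
      \<Rightarrow> ('o, 'm, ('v, 'w) vcat, 'w \<Rightarrow> 'w) func \<Rightarrow> ('o, 'm, 'p, 'n) func \<Rightarrow> 'p \<Rightarrow> bool" where
  "weighted_colimit A X W F C \<longleftrightarrow> (\<exists>\<phi>. colimit_iso A X W F C \<phi>)"

text \<open>\<open>K\<close> is $b \mapsto B(J-,b)*H$: on objects it gives weighted colimits, and on an arrow
  \<open>g : b \<rightarrow> b'\<close> it is the arrow induced by the weight transformation $B(J-,g)$.\<close>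

definition kan_colimit_functor ::
    "('o, 'm, 'v::commutative_quantale) ecat \<Rightarrow> ('q, 'k, 'v) ecat \<Rightarrow> ('p, 'n, 'v) ecat
      \<Rightarrow> ('o, 'm, 'q, 'k) func \<Rightarrow> ('o, 'm, 'p, 'n) func \<Rightarrow> ('q, 'k, 'p, 'n) func \<Rightarrow> bool" where
  "kan_colimit_functor A B X J H K \<longleftrightarrow>
     enriched_functor A B J \<and> enriched_functor B X K \<and>
     (\<exists>\<kappa>. (\<forall>b\<in>Ob B. colimit_iso A X (hom_weight A B J b) H (omap K b) (\<kappa> b)) \<and>
       (\<forall>b\<in>Ob B. \<forall>b'\<in>Ob B. \<forall>g\<in>Arr B b b'. \<forall>Z\<in>Ob X. \<forall>h\<in>Arr X (omap K b') Z.
          \<kappa> b Z (Comp X (omap K b) (omap K b') Z h (amap K b b' g)) =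
            (\<lambda>a\<in>Ob A. \<lambda>w\<in>Arr B (omap J a) b.
               \<kappa> b' Z h a (Comp B (omap J a) b b' g w))))"

definition left_kan_extension ::
    "('o, 'm, 'v::commutative_quantale) ecat \<Rightarrow> ('q, 'k, 'v) ecat \<Rightarrow> ('p, 'n, 'v) ecat
      \<Rightarrow> ('o, 'm, 'q, 'k) func \<Rightarrow> ('o, 'm, 'p, 'n) func \<Rightarrow> ('q, 'k, 'p, 'n) func \<Rightarrow> bool" where
  "left_kan_extension A B X J H L \<longleftrightarrow>
     enriched_functor B X L \<and>
     (\<exists>K \<theta>. kan_colimit_functor A B X J H K \<and> natural_iso B X L K \<theta>)"


section \<open>The category N, the weight N and the diagram of a V-category\<close>

datatype 'v n_ob = Base | Level 'v

text \<open>\<open>Delta i r\<close> is $\delta^r_i$, for \<open>i\<close> among 0 and 1.\<close>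

datatype 'v n_arr = NId "'v n_ob" | Delta nat 'v

fun n_arrows :: "'v n_ob \<Rightarrow> 'v n_ob \<Rightarrow> 'v n_arr set" where
  "n_arrows Base Base = {NId Base}"
| "n_arrows (Level r) (Level s) = (if r = s then {NId (Level r)} else {})"
| "n_arrows (Level r) Base = {Delta 0 r, Delta 1 r}"
| "n_arrows Base (Level r) = {}"

text \<open>In any composable pair at least one arrow is an identity.\<close>

fun n_comp :: "'v n_arr \<Rightarrow> 'v n_arr \<Rightarrow> 'v n_arr" where
  "n_comp (NId _) f = f"
| "n_comp (Delta i r) _ = Delta i r"

definition N_cat :: "('v n_ob, 'v n_arr, 'v::commutative_quantale) ecat" where
  "N_cat = \<lparr>Ob = UNIV, Hom = (\<lambda>a b. discrete (n_arrows a b)), Id = NId,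
     Comp = (\<lambda>_ _ _. n_comp)\<rparr>"

definition one_vcat :: "('v::commutative_quantale, nat) vcat" where
  "one_vcat = mk_vcat {0} (\<lambda>_ _. 1)"

definition two_vcat :: "'v::commutative_quantale \<Rightarrow> ('v, nat) vcat" where
  "two_vcat r = mk_vcat {0, 1} (\<lambda>i j. if i = j then 1 else if i = 0 then r else bot)"

fun N_ob :: "'v n_ob \<Rightarrow> ('v::commutative_quantale, nat) vcat" where
  "N_ob Base = one_vcat"
| "N_ob (Level r) = two_vcat r"

fun N_arr :: "'v::commutative_quantale n_arr \<Rightarrow> nat \<Rightarrow> nat" where
  "N_arr (NId a) = (\<lambda>x\<in>Obj (N_ob a). x)"
| "N_arr (Delta i r) = (\<lambda>_\<in>{0}. i)"

text \<open>An arrow \<open>a \<rightarrow> b\<close> of the opposite category is an arrow \<open>b \<rightarrow> a\<close> of \<open>N_cat\<close>.\<close>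

definition N_weight ::
    "('v n_ob, 'v n_arr, ('v::commutative_quantale, nat) vcat, nat \<Rightarrow> nat) func" where
  "N_weight = \<lparr>omap = N_ob, amap = (\<lambda>a b. \<lambda>f\<in>n_arrows b a. N_arr f)\<rparr>"

text \<open>$X_r$, with a pair $(x',x)$ coded as \<open>pair (x', x)\<close>.\<close>

fun F_ob :: "('u \<times> 'u \<Rightarrow> 'u) \<Rightarrow> ('v::commutative_quantale, 'u) vcat \<Rightarrow> 'v n_ob \<Rightarrow> 'u set" where
  "F_ob pair X Base = Obj X"
| "F_ob pair X (Level r) = pair ` {(x', x) \<in> Obj X \<times> Obj X. r \<le> Dist X x' x}"

fun F_arr ::
    "('u \<times> 'u \<Rightarrow> 'u) \<Rightarrow> ('v::commutative_quantale, 'u) vcat \<Rightarrow> 'v n_arr \<Rightarrow> 'u \<Rightarrow> 'u" where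
  "F_arr pair X (NId a) = (\<lambda>x\<in>F_ob pair X a. x)"
| "F_arr pair X (Delta i r) =
     (\<lambda>z\<in>F_ob pair X (Level r). (if i = 0 then fst else snd) (inv pair z))"

definition F_func ::
    "('u \<times> 'u \<Rightarrow> 'u) \<Rightarrow> ('v::commutative_quantale, 'u) vcat
      \<Rightarrow> ('v n_ob, 'v n_arr, 'u set, 'u \<Rightarrow> 'u) func" where
  "F_func pair X = \<lparr>omap = F_ob pair X, amap = (\<lambda>a b. \<lambda>f\<in>n_arrows a b. F_arr pair X f)\<rparr>"

end

theory Submission
  imports Defs
begin

text \<open>V-categories need not be separated, so $H^\sharp\mathcal X$ is obtained without a quotient: it has the
  objects of \<open>H (Obj X)\<close>, and its distance is the infimum of all transitive distances that dominate
  the one of \<open>H (Obj X)\<close> and satisfy $[D S,\mathcal X](w,w') \le d(Hw\,a, Hw'\,a)$ for all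
  \<open>w, w' : S \<rightarrow> Obj X\<close> and all \<open>a\<close> in \<open>H S\<close>. This condition says that $w \mapsto h \circ Hw$ is a
  V-functor $[D S,\mathcal X]\to[H S,\mathcal Z]$ for each V-functor $h : H^\sharp\mathcal X\to\mathcal Z$. Conversely a
  natural family $\alpha_S : [D S,\mathcal X]\to[H S,\mathcal Z]$ is determined by its value at the identity
  of \<open>Obj X\<close>, as in the Yoneda lemma. For the weight $N$ the same works because a
  pair \<open>(w, w')\<close> at distance \<open>r\<close> factors through $X_r$, so that the condition need only be
  imposed on the two projections of $X_r$.\<close>

section \<open>V-categories and V-functors\<close>

text \<open>Tensoring with a fixed element is a left adjoint, hence preserves the bottom
  element.\<close>

lemma bot_tensor [simp]: "(bot::'v::commutative_quantale) * x = bot" "x * (bot::'v) = bot"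
proof -
  show "bot * x = bot" by (simp add: bot_unique[symmetric] residual_adjoint)
  then show "x * bot = bot" by (simp add: mult.commute)
qed

lemma Obj_mk_vcat [simp]: "Obj (mk_vcat S d) = S"
  by (simp add: mk_vcat_def)

lemma Dist_mk_vcat [simp]: "x \<in> S \<Longrightarrow> y \<in> S \<Longrightarrow> Dist (mk_vcat S d) x y = d x y"
  by (simp add: mk_vcat_def)

lemma V_category_mk_vcatI:
  assumes "\<And>x. x \<in> S \<Longrightarrow> 1 \<le> d x x"
    and "\<And>x y z. x \<in> S \<Longrightarrow> y \<in> S \<Longrightarrow> z \<in> S \<Longrightarrow> d y z * d x y \<le> d x z"
  shows "V_category (mk_vcat S d)"
  using assms by (auto simp: V_category_def mk_vcat_def)

lemma V_category_refl: "V_category X \<Longrightarrow> x \<in> Obj X \<Longrightarrow> 1 \<le> Dist X x x"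
  by (simp add: V_category_def)

lemma V_category_trans:
  "V_category X \<Longrightarrow> x \<in> Obj X \<Longrightarrow> y \<in> Obj X \<Longrightarrow> z \<in> Obj X \<Longrightarrow> Dist X y z * Dist X x y \<le> Dist X x z"
  by (simp add: V_category_def)

lemma V_functorsI:
  assumes "f \<in> Obj X \<rightarrow>\<^sub>E Obj Y"
    and "\<And>x y. x \<in> Obj X \<Longrightarrow> y \<in> Obj X \<Longrightarrow> Dist X x y \<le> Dist Y (f x) (f y)"
  shows "f \<in> V_functors X Y"
  using assms by (simp add: V_functors_def)

lemma V_functors_PiE: "f \<in> V_functors X Y \<Longrightarrow> f \<in> Obj X \<rightarrow>\<^sub>E Obj Y"
  by (simp add: V_functors_def)

lemma V_functors_mem: "f \<in> V_functors X Y \<Longrightarrow> x \<in> Obj X \<Longrightarrow> f x \<in> Obj Y"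
  by (auto simp: V_functors_def)

lemma V_functors_ext: "f \<in> V_functors X Y \<Longrightarrow> f \<in> extensional (Obj X)"
  by (auto simp: V_functors_def PiE_def)

lemma V_functors_le:
  "f \<in> V_functors X Y \<Longrightarrow> x \<in> Obj X \<Longrightarrow> y \<in> Obj X \<Longrightarrow> Dist X x y \<le> Dist Y (f x) (f y)"
  by (simp add: V_functors_def)

lemma V_functors_compose:
  assumes "f \<in> V_functors X Y" "g \<in> V_functors Y Z"
  shows "compose (Obj X) g f \<in> V_functors X Z"
proof (rule V_functorsI)
  show "compose (Obj X) g f \<in> Obj X \<rightarrow>\<^sub>E Obj Z"
    using assms by (auto simp: compose_def dest: V_functors_mem)
next
  fix x y assume "x \<in> Obj X" "y \<in> Obj X"
  then show "Dist X x y \<le> Dist Z (compose (Obj X) g f x) (compose (Obj X) g f y)"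
    using V_functors_le[OF assms(1), of x y] V_functors_le[OF assms(2), of "f x" "f y"]
      V_functors_mem[OF assms(1)]
    by (auto simp: compose_def intro: order_trans)
qed

lemma V_functors_id: "(\<lambda>x\<in>Obj X. x) \<in> V_functors X X"
  by (auto intro!: V_functorsI)

section \<open>Discrete V-categories, tensor products and internal homs\<close>

lemma Obj_discrete [simp]: "Obj (discrete S) = S"
  by (simp add: discrete_def)

lemma Dist_discrete [simp]:
  "x \<in> S \<Longrightarrow> y \<in> S \<Longrightarrow> Dist (discrete S) x y = (if x = y then 1 else bot)"
  by (simp add: discrete_def)

lemma V_category_discrete: "V_category (discrete S)"
  unfolding discrete_def by (rule V_category_mk_vcatI) auto

text \<open>Off the diagonal the distance is \<open>bot\<close> and constrains nothing; on the
  diagonal it is \<open>1\<close>, and the inequality is reflexivity in \<open>Y\<close>.\<close>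

lemma V_functors_discrete:
  assumes "V_category Y"
  shows "V_functors (discrete S) Y = (S \<rightarrow>\<^sub>E Obj Y)"
proof
  show "V_functors (discrete S) Y \<subseteq> (S \<rightarrow>\<^sub>E Obj Y)"
    by (auto simp: V_functors_def)
  show "(S \<rightarrow>\<^sub>E Obj Y) \<subseteq> V_functors (discrete S) Y"
  proof
    fix f assume "f \<in> S \<rightarrow>\<^sub>E Obj Y"
    then show "f \<in> V_functors (discrete S) Y"
      by (intro V_functorsI) (auto intro!: V_category_refl[OF assms])
  qed
qed

lemma Obj_tensor [simp]: "Obj (tensor X Y) = Obj X \<times> Obj Y"
  by (simp add: tensor_def)

lemma Dist_tensor [simp]:
  "x \<in> Obj X \<Longrightarrow> x' \<in> Obj X \<Longrightarrow> y \<in> Obj Y \<Longrightarrow> y' \<in> Obj Y \<Longrightarrow>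
    Dist (tensor X Y) (x, y) (x', y') = Dist X x x' * Dist Y y y'"
  by (simp add: tensor_def)

lemma Obj_internal_hom [simp]: "Obj (internal_hom X Y) = V_functors X Y"
  by (simp add: internal_hom_def)

lemma Dist_internal_hom:
  "f \<in> V_functors X Y \<Longrightarrow> g \<in> V_functors X Y \<Longrightarrow>
    Dist (internal_hom X Y) f g = (INF x\<in>Obj X. Dist Y (f x) (g x))"
  by (simp add: internal_hom_def)

lemma V_category_internal_hom:
  assumes "V_category Y"
  shows "V_category (internal_hom X Y)"
  unfolding internal_hom_def
proof (rule V_category_mk_vcatI)
  fix f assume "f \<in> V_functors X Y"
  then show "1 \<le> (INF x\<in>Obj X. Dist Y (f x) (f x))"
    by (auto intro!: INF_greatest V_category_refl[OF assms] dest: V_functors_mem)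
next
  fix f g h assume *: "f \<in> V_functors X Y" "g \<in> V_functors X Y" "h \<in> V_functors X Y"
  show "(INF x\<in>Obj X. Dist Y (g x) (h x)) * (INF x\<in>Obj X. Dist Y (f x) (g x))
        \<le> (INF x\<in>Obj X. Dist Y (f x) (h x))"
  proof (rule INF_greatest)
    fix x assume x: "x \<in> Obj X"
    have "(INF x\<in>Obj X. Dist Y (g x) (h x)) * (INF x\<in>Obj X. Dist Y (f x) (g x))
        \<le> Dist Y (g x) (h x) * Dist Y (f x) (g x)"
      by (intro tensor_mono INF_lower x)
    also have "\<dots> \<le> Dist Y (f x) (h x)"
      using * x by (intro V_category_trans[OF assms]) (auto dest: V_functors_mem)
    finally show "(INF x\<in>Obj X. Dist Y (g x) (h x)) * (INF x\<in>Obj X. Dist Y (f x) (g x))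
        \<le> Dist Y (f x) (h x)" .
  qed
qed

section \<open>Enriched categories and functors\<close>

lemma enriched_category_hom:
  "enriched_category A \<Longrightarrow> a \<in> Ob A \<Longrightarrow> b \<in> Ob A \<Longrightarrow> V_category (Hom A a b)"
  by (simp add: enriched_category_def)

lemma enriched_category_comp_mem:
  assumes "enriched_category A" "a \<in> Ob A" "b \<in> Ob A" "c \<in> Ob A" "f \<in> Arr A a b" "g \<in> Arr A b c"
  shows "Comp A a b c g f \<in> Arr A a c"
proof -
  have "(\<lambda>p\<in>Arr A b c \<times> Arr A a b. Comp A a b c (fst p) (snd p))
          \<in> V_functors (tensor (Hom A b c) (Hom A a b)) (Hom A a c)"
    using assms by (simp add: enriched_category_def)
  from V_functors_mem[OF this, of "(g, f)"] show ?thesis using assms by simp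
qed

lemma enriched_category_comp_le:
  assumes "enriched_category A" "a \<in> Ob A" "b \<in> Ob A" "c \<in> Ob A"
    "f \<in> Arr A a b" "g \<in> Arr A b c" "f' \<in> Arr A a b" "g' \<in> Arr A b c"
  shows "Dist (Hom A b c) g g' * Dist (Hom A a b) f f'
    \<le> Dist (Hom A a c) (Comp A a b c g f) (Comp A a b c g' f')"
proof -
  have "(\<lambda>p\<in>Arr A b c \<times> Arr A a b. Comp A a b c (fst p) (snd p))
          \<in> V_functors (tensor (Hom A b c) (Hom A a b)) (Hom A a c)"
    using assms by (simp add: enriched_category_def)
  from V_functors_le[OF this, of "(g, f)" "(g', f')"] show ?thesis using assms by simp
qed

text \<open>Replaces the V-functor out of the tensor product by two conditions on separate
  arguments: membership and an inequality of distances.\<close>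

lemma enriched_categoryI:
  assumes "\<And>a b. a \<in> Ob A \<Longrightarrow> b \<in> Ob A \<Longrightarrow> V_category (Hom A a b)"
    and "\<And>a. a \<in> Ob A \<Longrightarrow> Id A a \<in> Arr A a a"
    and "\<And>a b c f g. a \<in> Ob A \<Longrightarrow> b \<in> Ob A \<Longrightarrow> c \<in> Ob A \<Longrightarrow> f \<in> Arr A a b \<Longrightarrow> g \<in> Arr A b c \<Longrightarrow>
      Comp A a b c g f \<in> Arr A a c"
    and "\<And>a b c f g f' g'. a \<in> Ob A \<Longrightarrow> b \<in> Ob A \<Longrightarrow> c \<in> Ob A \<Longrightarrow>
      f \<in> Arr A a b \<Longrightarrow> g \<in> Arr A b c \<Longrightarrow> f' \<in> Arr A a b \<Longrightarrow> g' \<in> Arr A b c \<Longrightarrow>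
      Dist (Hom A b c) g g' * Dist (Hom A a b) f f'
        \<le> Dist (Hom A a c) (Comp A a b c g f) (Comp A a b c g' f')"
    and "\<And>a b f. a \<in> Ob A \<Longrightarrow> b \<in> Ob A \<Longrightarrow> f \<in> Arr A a b \<Longrightarrow> Comp A a a b f (Id A a) = f"
    and "\<And>a b f. a \<in> Ob A \<Longrightarrow> b \<in> Ob A \<Longrightarrow> f \<in> Arr A a b \<Longrightarrow> Comp A a b b (Id A b) f = f"
    and "\<And>a b c d f g h. a \<in> Ob A \<Longrightarrow> b \<in> Ob A \<Longrightarrow> c \<in> Ob A \<Longrightarrow> d \<in> Ob A \<Longrightarrow>
      f \<in> Arr A a b \<Longrightarrow> g \<in> Arr A b c \<Longrightarrow> h \<in> Arr A c d \<Longrightarrow>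
        Comp A a b d (Comp A b c d h g) f = Comp A a c d h (Comp A a b c g f)"
  shows "enriched_category A"
  unfolding enriched_category_def
proof (intro conjI ballI)
  fix a b c assume "a \<in> Ob A" "b \<in> Ob A" "c \<in> Ob A"
  then show "(\<lambda>p\<in>Arr A b c \<times> Arr A a b. Comp A a b c (fst p) (snd p))
          \<in> V_functors (tensor (Hom A b c) (Hom A a b)) (Hom A a c)"
    using assms(3,4) by (intro V_functorsI) auto
qed (use assms in auto)

text \<open>Passing to the opposite swaps the two tensor factors, so commutativity of the quantale
  enters here.\<close>

lemma enriched_category_op:
  assumes "enriched_category A"
  shows "enriched_category (op_cat A)"
proof (rule enriched_categoryI)
  fix a b c f g f' g'
  assume "a \<in> Ob (op_cat A)" "b \<in> Ob (op_cat A)" "c \<in> Ob (op_cat A)"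
    "f \<in> Arr (op_cat A) a b" "g \<in> Arr (op_cat A) b c"
    "f' \<in> Arr (op_cat A) a b" "g' \<in> Arr (op_cat A) b c"
  then show "Dist (Hom (op_cat A) b c) g g' * Dist (Hom (op_cat A) a b) f f'
    \<le> Dist (Hom (op_cat A) a c) (Comp (op_cat A) a b c g f) (Comp (op_cat A) a b c g' f')"
    using enriched_category_comp_le[OF assms, of c b a g f g' f']
    by (simp add: op_cat_def mult.commute)
qed (use assms enriched_category_comp_mem[OF assms] in \<open>auto simp: op_cat_def enriched_category_def\<close>)

text \<open>Between discrete homs the distance inequality is automatic: its left side is
  \<open>1\<close> if both pairs of arrows coincide and \<open>bot\<close> otherwise.\<close>

lemma enriched_category_discreteI:
  assumes "\<And>a b. a \<in> Ob A \<Longrightarrow> b \<in> Ob A \<Longrightarrow> Hom A a b = discrete (Arr A a b)"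
    and "\<And>a. a \<in> Ob A \<Longrightarrow> Id A a \<in> Arr A a a"
    and "\<And>a b c f g. a \<in> Ob A \<Longrightarrow> b \<in> Ob A \<Longrightarrow> c \<in> Ob A \<Longrightarrow> f \<in> Arr A a b \<Longrightarrow> g \<in> Arr A b c \<Longrightarrow>
      Comp A a b c g f \<in> Arr A a c"
    and "\<And>a b f. a \<in> Ob A \<Longrightarrow> b \<in> Ob A \<Longrightarrow> f \<in> Arr A a b \<Longrightarrow> Comp A a a b f (Id A a) = f"
    and "\<And>a b f. a \<in> Ob A \<Longrightarrow> b \<in> Ob A \<Longrightarrow> f \<in> Arr A a b \<Longrightarrow> Comp A a b b (Id A b) f = f"
    and "\<And>a b c d f g h. a \<in> Ob A \<Longrightarrow> b \<in> Ob A \<Longrightarrow> c \<in> Ob A \<Longrightarrow> d \<in> Ob A \<Longrightarrow>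
      f \<in> Arr A a b \<Longrightarrow> g \<in> Arr A b c \<Longrightarrow> h \<in> Arr A c d \<Longrightarrow>
        Comp A a b d (Comp A b c d h g) f = Comp A a c d h (Comp A a b c g f)"
  shows "enriched_category A"
proof -
  have d: "Dist (Hom A a b) f f' = (if f = f' then 1 else bot)"
    if "a \<in> Ob A" "b \<in> Ob A" "f \<in> Arr A a b" "f' \<in> Arr A a b" for a b f f'
    using that Dist_discrete[of f "Arr A a b" f'] assms(1)[of a b] by metis
  show ?thesis
  proof (rule enriched_categoryI)
    fix a b assume "a \<in> Ob A" "b \<in> Ob A"
    then show "V_category (Hom A a b)"
      using V_category_discrete assms(1) by metis
  next
    fix a b c f g f' g' assume "a \<in> Ob A" "b \<in> Ob A" "c \<in> Ob A" "f \<in> Arr A a b" "g \<in> Arr A b c"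
      "f' \<in> Arr A a b" "g' \<in> Arr A b c"
    then show "Dist (Hom A b c) g g' * Dist (Hom A a b) f f'
        \<le> Dist (Hom A a c) (Comp A a b c g f) (Comp A a b c g' f')"
      using assms(3) by (simp add: d)
  qed (use assms in auto)
qed

text \<open>Any function out of a discrete V-category is a V-functor, so ordinary functors out of
  \<open>SetCat U\<close> and \<open>N_cat\<close> are automatically enriched.\<close>

lemma enriched_functor_discreteI:
  assumes "enriched_category A" "enriched_category B" "ordinary_functor A B F"
    and "\<And>a b. a \<in> Ob A \<Longrightarrow> b \<in> Ob A \<Longrightarrow> Hom A a b = discrete (Arr A a b)"
  shows "enriched_functor A B F"
  unfolding enriched_functor_def
proof (intro conjI ballI assms(1-3))
  fix a b assume ab: "a \<in> Ob A" "b \<in> Ob A"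
  then have "V_category (Hom B (omap F a) (omap F b))"
    using assms(2,3) by (auto simp: ordinary_functor_def intro: enriched_category_hom)
  then show "amap F a b \<in> V_functors (Hom A a b) (Hom B (omap F a) (omap F b))"
    using assms(3) ab by (subst assms(4)) (auto simp: V_functors_discrete ordinary_functor_def)
qed

lemma ordinary_functorD:
  assumes "ordinary_functor A B F"
  shows "a \<in> Ob A \<Longrightarrow> omap F a \<in> Ob B"
    and "a \<in> Ob A \<Longrightarrow> b \<in> Ob A \<Longrightarrow> amap F a b \<in> extensional (Arr A a b)"
    and "a \<in> Ob A \<Longrightarrow> b \<in> Ob A \<Longrightarrow> f \<in> Arr A a b \<Longrightarrow> amap F a b f \<in> Arr B (omap F a) (omap F b)"
    and "a \<in> Ob A \<Longrightarrow> amap F a a (Id A a) = Id B (omap F a)"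
    and "a \<in> Ob A \<Longrightarrow> b \<in> Ob A \<Longrightarrow> c \<in> Ob A \<Longrightarrow> f \<in> Arr A a b \<Longrightarrow> g \<in> Arr A b c \<Longrightarrow>
      amap F a c (Comp A a b c g f) =
        Comp B (omap F a) (omap F b) (omap F c) (amap F b c g) (amap F a b f)"
  using assms unfolding ordinary_functor_def PiE_def by blast+

lemma ordinary_functor_comp:
  assumes "enriched_category A" "ordinary_functor A B F" "ordinary_functor B C G"
  shows "ordinary_functor A C (comp_func A G F)"
proof -
  have "Id A a \<in> Arr A a a" if "a \<in> Ob A" for a
    using assms(1) that by (simp add: enriched_category_def)
  then show ?thesis
    unfolding ordinary_functor_def comp_func_def
    by (auto simp: ordinary_functorD[OF assms(2)] ordinary_functorD[OF assms(3)]
        enriched_category_comp_mem[OF assms(1)])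
qed

section \<open>The enriched categories of V-categories, of sets, and N\<close>

lemma VCat_simps [simp]:
  "Ob (VCat U) = {X. V_category X \<and> Obj X \<in> U}"
  "Hom (VCat U) = internal_hom"
  "Id (VCat U) = (\<lambda>X. \<lambda>x\<in>Obj X. x)"
  "Comp (VCat U) X Y Z g f = compose (Obj X) g f"
  by (simp_all add: VCat_def)

lemma SetCat_simps [simp]:
  "Ob (SetCat U) = U"
  "Hom (SetCat U) S T = discrete (S \<rightarrow>\<^sub>E T)"
  "Id (SetCat U) = (\<lambda>S. \<lambda>x\<in>S. x)"
  "Comp (SetCat U) S T R g f = compose S g f"
  by (simp_all add: SetCat_def)

lemma op_cat_simps [simp]:
  "Ob (op_cat A) = Ob A"
  "Hom (op_cat A) a b = Hom A b a"
  "Id (op_cat A) = Id A"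
  "Comp (op_cat A) a b c g f = Comp A c b a f g"
  by (simp_all add: op_cat_def)

lemma N_cat_simps [simp]:
  "Ob N_cat = UNIV"
  "Hom N_cat a b = discrete (n_arrows a b)"
  "Id N_cat = NId"
  "Comp N_cat a b c g f = n_comp g f"
  by (simp_all add: N_cat_def)

lemma enriched_category_VCat: "enriched_category (VCat U)"
proof (rule enriched_categoryI)
  fix X Y Z :: "('a, 'b) vcat" and f g f' g'
  assume XYZ: "X \<in> Ob (VCat U)" "Y \<in> Ob (VCat U)" "Z \<in> Ob (VCat U)"
    and "f \<in> Arr (VCat U) X Y" "g \<in> Arr (VCat U) Y Z" "f' \<in> Arr (VCat U) X Y" "g' \<in> Arr (VCat U) Y Z"
  then have f: "f \<in> V_functors X Y" "f' \<in> V_functors X Y"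
    and g: "g \<in> V_functors Y Z" "g' \<in> V_functors Y Z"
    by auto
  have "Dist (internal_hom Y Z) g g' * Dist (internal_hom X Y) f f'
      \<le> Dist (internal_hom X Z) (compose (Obj X) g f) (compose (Obj X) g' f')"
    unfolding Dist_internal_hom[OF g] Dist_internal_hom[OF f]
      Dist_internal_hom[OF V_functors_compose[OF f(1) g(1)] V_functors_compose[OF f(2) g(2)]]
  proof (rule INF_greatest)
    fix x assume x: "x \<in> Obj X"
    note m = V_functors_mem[OF f(1) x] V_functors_mem[OF f(2) x]
    \<comment> \<open>The chain goes through the intermediate object \<open>g (f' x)\<close>: the
      first infimum is taken at \<open>f' x\<close>, the second at \<open>x\<close>, and
      \<open>g\<close> carries the latter into \<open>Z\<close> before transitivity applies.\<close>
    have "(INF y\<in>Obj Y. Dist Z (g y) (g' y)) * (INF x\<in>Obj X. Dist Y (f x) (f' x))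
        \<le> Dist Z (g (f' x)) (g' (f' x)) * Dist Y (f x) (f' x)"
      by (intro tensor_mono INF_lower x m)
    also have "\<dots> \<le> Dist Z (g (f' x)) (g' (f' x)) * Dist Z (g (f x)) (g (f' x))"
      by (intro tensor_mono order_refl V_functors_le[OF g(1)] m)
    also have "\<dots> \<le> Dist Z (g (f x)) (g' (f' x))"
      using XYZ m g by (intro V_category_trans) (auto intro: V_functors_mem)
    finally show "(INF y\<in>Obj Y. Dist Z (g y) (g' y)) * (INF x\<in>Obj X. Dist Y (f x) (f' x))
        \<le> Dist Z (compose (Obj X) g f x) (compose (Obj X) g' f' x)"
      using x by (simp add: compose_def)
  qed
  then show "Dist (Hom (VCat U) Y Z) g g' * Dist (Hom (VCat U) X Y) f f'
      \<le> Dist (Hom (VCat U) X Z) (Comp (VCat U) X Y Z g f) (Comp (VCat U) X Y Z g' f')"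
    by simp
next
  fix X Y Z V :: "('a, 'b) vcat" and f g h
  assume "f \<in> Arr (VCat U) X Y"
  then show "Comp (VCat U) X Y V (Comp (VCat U) Y Z V h g) f =
      Comp (VCat U) X Z V h (Comp (VCat U) X Y Z g f)"
    by (auto simp: compose_def fun_eq_iff dest: V_functors_mem)
next
  fix X Y :: "('a, 'b) vcat" and f
  assume "f \<in> Arr (VCat U) X Y"
  then have f: "f \<in> V_functors X Y" by simp
  show "Comp (VCat U) X X Y f (Id (VCat U) X) = f"
    using V_functors_ext[OF f] by (auto simp: compose_def extensional_def fun_eq_iff)
  show "Comp (VCat U) X Y Y (Id (VCat U) Y) f = f"
    using V_functors_ext[OF f] V_functors_mem[OF f] by (auto simp: compose_def extensional_def fun_eq_iff)
qed (auto intro: V_category_internal_hom V_functors_id V_functors_compose)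

lemma enriched_category_SetCat: "enriched_category (SetCat U)"
proof (rule enriched_category_discreteI)
qed (auto simp: compose_def extensional_def fun_eq_iff PiE_iff split: if_splits)

lemma enriched_category_N_cat: "enriched_category N_cat"
proof (rule enriched_category_discreteI)
  fix a b c d :: "'v::commutative_quantale n_ob" and f g h
  show "f \<in> Arr N_cat a b \<Longrightarrow> g \<in> Arr N_cat b c \<Longrightarrow> Comp N_cat a b c g f \<in> Arr N_cat a c"
    by (cases a; cases b; cases c) (auto split: if_splits)
  show "f \<in> Arr N_cat a b \<Longrightarrow> Comp N_cat a a b f (Id N_cat a) = f"
    "f \<in> Arr N_cat a b \<Longrightarrow> Comp N_cat a b b (Id N_cat b) f = f"
    by (cases a; cases b; auto split: if_splits)+
  show "f \<in> Arr N_cat a b \<Longrightarrow> g \<in> Arr N_cat b c \<Longrightarrow> h \<in> Arr N_cat c d \<Longrightarrow>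
      Comp N_cat a b d (Comp N_cat b c d h g) f = Comp N_cat a c d h (Comp N_cat a b c g f)"
    by (cases h; cases g) auto
  show "Id N_cat a \<in> Arr N_cat a a"
    by (cases a) auto
qed simp

section \<open>Representable weights\<close>

text \<open>The weights \<open>B(J-,b)\<close> in the definition of the Kan extension are of this
  form, and \<open>colimit_iso\<close> demands that they be enriched. Everything reduces to
  composition in \<open>X\<close> being V-functorial in both arguments jointly.\<close>

lemma enriched_functor_hom_weight:
  assumes "enriched_functor A X F" "Z \<in> Ob X"
  shows "enriched_functor (op_cat A) (VCat UNIV) (hom_weight A X F Z)"
proof -
  have A: "enriched_category A" and X: "enriched_category X" and F: "ordinary_functor A X F"
    and FV: "\<And>a b. a \<in> Ob A \<Longrightarrow> b \<in> Ob A \<Longrightarrow>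
      amap F a b \<in> V_functors (Hom A a b) (Hom X (omap F a) (omap F b))"
    using assms(1) by (auto simp: enriched_functor_def)
  note Fd = ordinary_functorD[OF F]
  \<comment> \<open>The joint estimate in \<open>h\<close> and \<open>f\<close>; both
    V-functoriality statements below arise by keeping one of the two arguments fixed.\<close>
  have le: "Dist (Hom X (omap F a) Z) h h' * Dist (Hom A b a) f f' \<le>
      Dist (Hom X (omap F b) Z) (Comp X (omap F b) (omap F a) Z h (amap F b a f))
        (Comp X (omap F b) (omap F a) Z h' (amap F b a f'))"
    if "a \<in> Ob A" "b \<in> Ob A" "f \<in> Arr A b a" "f' \<in> Arr A b a"
      "h \<in> Arr X (omap F a) Z" "h' \<in> Arr X (omap F a) Z" for a b f f' h h'
  proof -
    have "Dist (Hom X (omap F a) Z) h h' * Dist (Hom A b a) f f'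
      \<le> Dist (Hom X (omap F a) Z) h h' * Dist (Hom X (omap F b) (omap F a)) (amap F b a f) (amap F b a f')"
      using that by (intro tensor_mono order_refl V_functors_le[OF FV])
    also have "\<dots> \<le> Dist (Hom X (omap F b) Z) (Comp X (omap F b) (omap F a) Z h (amap F b a f))
        (Comp X (omap F b) (omap F a) Z h' (amap F b a f'))"
      using that assms(2) by (intro enriched_category_comp_le[OF X] Fd)
    finally show ?thesis .
  qed
  have mem: "Comp X (omap F b) (omap F a) Z h (amap F b a f) \<in> Arr X (omap F b) Z"
    if "a \<in> Ob A" "b \<in> Ob A" "f \<in> Arr A b a" "h \<in> Arr X (omap F a) Z" for a b f h
    using that assms(2) by (intro enriched_category_comp_mem[OF X] Fd)
  \<comment> \<open>A fixed argument contributes its self-distance, which is at least the unit and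
    can therefore be dropped from the left side.\<close>
  have unitl: "x \<le> y" if "x * d \<le> y" "1 \<le> d" for x y d :: 'c
    using that tensor_mono[of x x 1 d] by simp
  have vf: "(\<lambda>h\<in>Arr X (omap F a) Z. Comp X (omap F b) (omap F a) Z h (amap F b a f))
      \<in> V_functors (Hom X (omap F a) Z) (Hom X (omap F b) Z)"
    if "a \<in> Ob A" "b \<in> Ob A" "f \<in> Arr A b a" for a b f
  proof (rule V_functorsI, goal_cases)
    case 1
    then show ?case using mem that by auto
  next
    case (2 h h')
    show ?case
      using le[OF that(1,2,3,3) 2] V_category_refl[OF enriched_category_hom[OF A that(2,1)] that(3)] 2
      by (auto intro: unitl)
  qed
  have id: "Id A a \<in> Arr A a a" if "a \<in> Ob A" for a
    using A that by (simp add: enriched_category_def)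
  have unit: "Comp X a b b' h (Id X a) = h" if "a \<in> Ob X" "b' \<in> Ob X" "h \<in> Arr X a b'" "b = a" for a b b' h
    using X that by (simp add: enriched_category_def)
  have assoc: "Comp X a b d (Comp X b c d h g) f = Comp X a c d h (Comp X a b c g f)"
    if "a \<in> Ob X" "b \<in> Ob X" "c \<in> Ob X" "d \<in> Ob X"
      "f \<in> Arr X a b" "g \<in> Arr X b c" "h \<in> Arr X c d" for a b c d f g h
    using X that unfolding enriched_category_def by blast
  have ord: "ordinary_functor (op_cat A) (VCat UNIV) (hom_weight A X F Z)"
    unfolding ordinary_functor_def
  proof (intro conjI ballI)
    fix a b c f g assume *: "a \<in> Ob (op_cat A)" "b \<in> Ob (op_cat A)" "c \<in> Ob (op_cat A)"
      "f \<in> Arr (op_cat A) a b" "g \<in> Arr (op_cat A) b c"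
    then show "amap (hom_weight A X F Z) a c (Comp (op_cat A) a b c g f) =
          Comp (VCat UNIV) (omap (hom_weight A X F Z) a) (omap (hom_weight A X F Z) b)
            (omap (hom_weight A X F Z) c) (amap (hom_weight A X F Z) b c g)
            (amap (hom_weight A X F Z) a b f)"
      using assms(2)
      by (auto simp: hom_weight_def compose_def fun_eq_iff enriched_category_comp_mem[OF A] mem
          Fd assoc)
  qed (use assms(2) in \<open>auto simp: hom_weight_def vf id Fd unit intro!: enriched_category_hom[OF X]\<close>)
  show ?thesis
    unfolding enriched_functor_def
  proof (intro conjI ballI ord enriched_category_op A enriched_category_VCat)
    fix a b assume ab: "a \<in> Ob (op_cat A)" "b \<in> Ob (op_cat A)"
    then have ab': "a \<in> Ob A" "b \<in> Ob A" by auto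
    show "amap (hom_weight A X F Z) a b \<in> V_functors (Hom (op_cat A) a b)
        (Hom (VCat UNIV) (omap (hom_weight A X F Z) a) (omap (hom_weight A X F Z) b))"
    proof (rule V_functorsI, goal_cases)
      case 1
      then show ?case using ord ab by (simp add: ordinary_functor_def)
    next
      case (2 f f')
      then have f: "f \<in> Arr A b a" "f' \<in> Arr A b a" by auto
      have "Dist (Hom A b a) f f' \<le> (INF h\<in>Arr X (omap F a) Z.
        Dist (Hom X (omap F b) Z) (Comp X (omap F b) (omap F a) Z h (amap F b a f))
          (Comp X (omap F b) (omap F a) Z h (amap F b a f')))"
      proof (rule INF_greatest)
        fix h assume h: "h \<in> Arr X (omap F a) Z"
        have "1 \<le> Dist (Hom X (omap F a) Z) h h"
          using h ab' assms(2) by (intro V_category_refl enriched_category_hom[OF X] Fd)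
        then show "Dist (Hom A b a) f f' \<le>
            Dist (Hom X (omap F b) Z) (Comp X (omap F b) (omap F a) Z h (amap F b a f))
              (Comp X (omap F b) (omap F a) Z h (amap F b a f'))"
          using le[OF ab' f h h] by (auto intro: unitl simp: mult.commute)
      qed
      then show ?case
        using f ab' by (simp add: hom_weight_def Dist_internal_hom vf)
    qed
  qed
qed

section \<open>Isomorphisms of V-categories and V-categories of natural transformations\<close>

text \<open>An inverse on objects suffices: since distances are preserved exactly, its
  V-functoriality follows. It is restricted to \<open>Obj Y\<close> because V-functors are
  extensional.\<close>

lemma V_isoI:
  assumes "\<phi> \<in> Obj X \<rightarrow>\<^sub>E Obj Y" "\<And>y. y \<in> Obj Y \<Longrightarrow> \<psi> y \<in> Obj X"
    and "\<And>x. x \<in> Obj X \<Longrightarrow> \<psi> (\<phi> x) = x" "\<And>y. y \<in> Obj Y \<Longrightarrow> \<phi> (\<psi> y) = y"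
    and "\<And>x x'. x \<in> Obj X \<Longrightarrow> x' \<in> Obj X \<Longrightarrow> Dist Y (\<phi> x) (\<phi> x') = Dist X x x'"
  shows "V_iso X Y \<phi>"
  unfolding V_iso_def
proof (intro conjI bexI[of _ "restrict \<psi> (Obj Y)"] ballI)
  show "\<phi> \<in> V_functors X Y"
    using assms by (intro V_functorsI) auto
  show "restrict \<psi> (Obj Y) \<in> V_functors Y X"
  proof (rule V_functorsI)
    fix y y' assume "y \<in> Obj Y" "y' \<in> Obj Y"
    then show "Dist Y y y' \<le> Dist X (restrict \<psi> (Obj Y) y) (restrict \<psi> (Obj Y) y')"
      using assms(5)[of "\<psi> y" "\<psi> y'"] assms by simp
  qed (use assms in auto)
  show "restrict \<psi> (Obj Y) (\<phi> x) = x" if "x \<in> Obj X" for x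
    using that assms by auto
  show "\<phi> (restrict \<psi> (Obj Y) y) = y" if "y \<in> Obj Y" for y
    using that assms by auto
qed

lemma Obj_nat_hom:
  "Obj (nat_hom A W G) = {\<alpha> \<in> (\<Pi>\<^sub>E a\<in>Ob A. V_functors (omap W a) (omap G a)).
        \<forall>a\<in>Ob A. \<forall>b\<in>Ob A. \<forall>f\<in>Arr A a b.
          compose (Obj (omap W a)) (amap G a b f) (\<alpha> a) =
          compose (Obj (omap W a)) (\<alpha> b) (amap W a b f)}"
  by (simp add: nat_hom_def)

lemma Dist_nat_hom:
  assumes "\<alpha> \<in> Obj (nat_hom A W G)" "\<beta> \<in> Obj (nat_hom A W G)"
  shows "Dist (nat_hom A W G) \<alpha> \<beta> =
    (INF a\<in>Ob A. INF w\<in>Obj (omap W a). Dist (omap G a) (\<alpha> a w) (\<beta> a w))"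
proof -
  have "Dist (nat_hom A W G) \<alpha> \<beta> =
      (INF a\<in>Ob A. Dist (internal_hom (omap W a) (omap G a)) (\<alpha> a) (\<beta> a))"
    using assms unfolding Obj_nat_hom by (simp add: nat_hom_def)
  also have "\<dots> = (INF a\<in>Ob A. INF w\<in>Obj (omap W a). Dist (omap G a) (\<alpha> a w) (\<beta> a w))"
    using assms unfolding Obj_nat_hom by (intro INF_cong refl Dist_internal_hom) auto
  finally show ?thesis .
qed

section \<open>The left Kan extension along the discrete functor\<close>

locale set_functor =
  fixes U :: "'u set set"
    and H :: "('u set, 'u \<Rightarrow> 'u, ('v::commutative_quantale, 'u) vcat, 'u \<Rightarrow> 'u) func"
  assumes ordinary: "ordinary_functor (SetCat U) (VCat U) H"
begin

lemma H_V_category: "S \<in> U \<Longrightarrow> V_category (omap H S)"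
  and H_Obj: "S \<in> U \<Longrightarrow> Obj (omap H S) \<in> U"
  using ordinary_functorD(1)[OF ordinary] by auto

lemma H_arr: "S \<in> U \<Longrightarrow> T \<in> U \<Longrightarrow> f \<in> S \<rightarrow>\<^sub>E T \<Longrightarrow> amap H S T f \<in> V_functors (omap H S) (omap H T)"
  using ordinary_functorD(3)[OF ordinary] by auto

lemma H_mem:
  "S \<in> U \<Longrightarrow> T \<in> U \<Longrightarrow> f \<in> S \<rightarrow>\<^sub>E T \<Longrightarrow> a \<in> Obj (omap H S) \<Longrightarrow> amap H S T f a \<in> Obj (omap H T)"
  by (rule V_functors_mem[OF H_arr])

lemma H_id: "S \<in> U \<Longrightarrow> amap H S S (\<lambda>x\<in>S. x) = (\<lambda>x\<in>Obj (omap H S). x)"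
  using ordinary_functorD(4)[OF ordinary] by simp

lemma H_compose:
  "S \<in> U \<Longrightarrow> T \<in> U \<Longrightarrow> R \<in> U \<Longrightarrow> f \<in> S \<rightarrow>\<^sub>E T \<Longrightarrow> g \<in> T \<rightarrow>\<^sub>E R \<Longrightarrow>
    amap H S R (compose S g f) = compose (Obj (omap H S)) (amap H T R g) (amap H S T f)"
  using ordinary_functorD(5)[OF ordinary, of S T R f g] by simp

lemma H_compose_apply:
  "S \<in> U \<Longrightarrow> T \<in> U \<Longrightarrow> R \<in> U \<Longrightarrow> f \<in> S \<rightarrow>\<^sub>E T \<Longrightarrow> g \<in> T \<rightarrow>\<^sub>E R \<Longrightarrow> a \<in> Obj (omap H S) \<Longrightarrow>
    amap H S R (compose S g f) a = amap H T R g (amap H S T f a)"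
  by (simp only: H_compose) (simp add: compose_def)

lemma enriched: "enriched_functor (SetCat U) (VCat U) H"
  by (rule enriched_functor_discreteI[OF enriched_category_SetCat enriched_category_VCat ordinary])
    simp

section \<open>The V-category \<open>sharp X\<close> and the V-functors out of it\<close>

text \<open>The infimum is the distance of \<open>w\<close> and \<open>w'\<close> as V-functors from
  the discrete \<open>S\<close> to \<open>X\<close>. For \<open>Obj X\<close> in \<open>U\<close>,
  both clauses constrain \<open>d\<close> only on the objects of
  \<open>omap H (Obj X)\<close>.\<close>

definition compatible :: "('v, 'u) vcat \<Rightarrow> ('u \<Rightarrow> 'u \<Rightarrow> 'v) \<Rightarrow> bool" where
  "compatible X d \<longleftrightarrow>
     (\<forall>a\<in>Obj (omap H (Obj X)). \<forall>b\<in>Obj (omap H (Obj X)). Dist (omap H (Obj X)) a b \<le> d a b) \<and>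
     (\<forall>S\<in>U. \<forall>w\<in>S \<rightarrow>\<^sub>E Obj X. \<forall>w'\<in>S \<rightarrow>\<^sub>E Obj X. \<forall>a\<in>Obj (omap H S).
        (INF s\<in>S. Dist X (w s) (w' s)) \<le> d (amap H S (Obj X) w a) (amap H S (Obj X) w' a))"

lemma compatible_INF:
  "compatible X d \<Longrightarrow> S \<in> U \<Longrightarrow> w \<in> S \<rightarrow>\<^sub>E Obj X \<Longrightarrow> w' \<in> S \<rightarrow>\<^sub>E Obj X \<Longrightarrow> a \<in> Obj (omap H S) \<Longrightarrow>
    (INF s\<in>S. Dist X (w s) (w' s)) \<le> d (amap H S (Obj X) w a) (amap H S (Obj X) w' a)"
  unfolding compatible_def by blast

definition transitive :: "'u set \<Rightarrow> ('u \<Rightarrow> 'u \<Rightarrow> 'v) \<Rightarrow> bool" where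
  "transitive S d \<longleftrightarrow> (\<forall>x\<in>S. \<forall>y\<in>S. \<forall>z\<in>S. d y z * d x y \<le> d x z)"

definition sharp :: "('v, 'u) vcat \<Rightarrow> ('v, 'u) vcat" where
  "sharp X = mk_vcat (Obj (omap H (Obj X)))
     (\<lambda>a b. INF d\<in>{d. compatible X d \<and> transitive (Obj (omap H (Obj X))) d}. d a b)"

lemma Obj_sharp [simp]: "Obj (sharp X) = Obj (omap H (Obj X))"
  by (simp add: sharp_def)

text \<open>Reflexivity is inherited from \<open>omap H (Obj X)\<close>, whose distance every
  compatible \<open>d\<close> dominates; transitivity passes to infima because the tensor is
  monotone.\<close>

lemma V_category_sharp:
  assumes "Obj X \<in> U"
  shows "V_category (sharp X)"
  unfolding sharp_def
proof (rule V_category_mk_vcatI)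
  fix a assume a: "a \<in> Obj (omap H (Obj X))"
  show "1 \<le> (INF d\<in>{d. compatible X d \<and> transitive (Obj (omap H (Obj X))) d}. d a a)"
    using a V_category_refl[OF H_V_category[OF assms] a]
    by (intro INF_greatest) (auto simp: compatible_def intro: order_trans)
next
  fix a b c
  assume *: "a \<in> Obj (omap H (Obj X))" "b \<in> Obj (omap H (Obj X))" "c \<in> Obj (omap H (Obj X))"
  let ?K = "{d. compatible X d \<and> transitive (Obj (omap H (Obj X))) d}"
  show "(INF d\<in>?K. d b c) * (INF d\<in>?K. d a b) \<le> (INF d\<in>?K. d a c)"
  proof (rule INF_greatest)
    fix d assume d: "d \<in> ?K"
    have "(INF d\<in>?K. d b c) * (INF d\<in>?K. d a b) \<le> d b c * d a b"
      by (intro tensor_mono INF_lower d)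
    also have "\<dots> \<le> d a c"
      using d * by (auto simp: transitive_def)
    finally show "(INF d\<in>?K. d b c) * (INF d\<in>?K. d a b) \<le> d a c" .
  qed
qed

text \<open>Both clauses of \<open>compatible\<close> are lower bounds on \<open>d\<close>, hence
  stable under infima.\<close>

lemma compatible_sharp:
  assumes "Obj X \<in> U"
  shows "compatible X (Dist (sharp X))"
  unfolding compatible_def
proof (intro conjI ballI)
  fix a b assume *: "a \<in> Obj (omap H (Obj X))" "b \<in> Obj (omap H (Obj X))"
  then show "Dist (omap H (Obj X)) a b \<le> Dist (sharp X) a b"
    by (auto simp: sharp_def compatible_def intro!: INF_greatest)
next
  fix S w w' a assume *: "S \<in> U" "w \<in> S \<rightarrow>\<^sub>E Obj X" "w' \<in> S \<rightarrow>\<^sub>E Obj X" "a \<in> Obj (omap H S)"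
  have "(INF s\<in>S. Dist X (w s) (w' s)) \<le> d (amap H S (Obj X) w a) (amap H S (Obj X) w' a)"
    if "compatible X d" for d
    using that * unfolding compatible_def by blast
  then show "(INF s\<in>S. Dist X (w s) (w' s)) \<le>
      Dist (sharp X) (amap H S (Obj X) w a) (amap H S (Obj X) w' a)"
    using * assms by (auto simp: sharp_def H_mem intro!: INF_greatest)
qed

text \<open>Pulling the distance of \<open>Z\<close> back along \<open>f\<close> gives a member of
  the family of which \<open>sharp X\<close> takes the infimum. With the converses
  \<open>sharp_V_functorsD\<close> and \<open>sharp_V_functors_INF\<close>, this characterises the
  V-functors out of \<open>sharp X\<close>.\<close>

lemma sharp_V_functorsI:
  assumes "V_category Z" "f \<in> V_functors (omap H (Obj X)) Z"
    and "\<And>S w w' a. S \<in> U \<Longrightarrow> w \<in> S \<rightarrow>\<^sub>E Obj X \<Longrightarrow> w' \<in> S \<rightarrow>\<^sub>E Obj X \<Longrightarrow> a \<in> Obj (omap H S) \<Longrightarrow>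
      (INF s\<in>S. Dist X (w s) (w' s)) \<le>
        Dist Z (f (amap H S (Obj X) w a)) (f (amap H S (Obj X) w' a))"
  shows "f \<in> V_functors (sharp X) Z"
proof (rule V_functorsI)
  let ?d = "\<lambda>a b. Dist Z (f a) (f b)"
  have "compatible X ?d"
    using assms(2,3) by (auto simp: compatible_def intro: V_functors_le)
  moreover have "transitive (Obj (omap H (Obj X))) ?d"
    using V_functors_mem[OF assms(2)] by (auto simp: transitive_def intro!: V_category_trans assms(1))
  ultimately have "?d \<in> {d. compatible X d \<and> transitive (Obj (omap H (Obj X))) d}"
    by simp
  from INF_lower[OF this] show "Dist (sharp X) a b \<le> Dist Z (f a) (f b)"
    if "a \<in> Obj (sharp X)" "b \<in> Obj (sharp X)" for a b
    using that by (simp add: sharp_def)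
qed (use assms(2) in \<open>simp add: V_functors_PiE\<close>)

lemma sharp_V_functorsD:
  assumes "Obj X \<in> U" "f \<in> V_functors (sharp X) Z"
  shows "f \<in> V_functors (omap H (Obj X)) Z"
proof (rule V_functorsI)
  show "f \<in> Obj (omap H (Obj X)) \<rightarrow>\<^sub>E Obj Z"
    using V_functors_PiE[OF assms(2)] by simp
  fix a b assume "a \<in> Obj (omap H (Obj X))" "b \<in> Obj (omap H (Obj X))"
  then show "Dist (omap H (Obj X)) a b \<le> Dist Z (f a) (f b)"
    using compatible_sharp[OF assms(1)] V_functors_le[OF assms(2), of a b]
    unfolding compatible_def by (auto intro: order_trans)
qed

lemma sharp_V_functors_INF:
  assumes "Obj X \<in> U" "f \<in> V_functors (sharp X) Z"
    and "S \<in> U" "w \<in> S \<rightarrow>\<^sub>E Obj X" "w' \<in> S \<rightarrow>\<^sub>E Obj X" "a \<in> Obj (omap H S)"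
  shows "(INF s\<in>S. Dist X (w s) (w' s)) \<le>
    Dist Z (f (amap H S (Obj X) w a)) (f (amap H S (Obj X) w' a))"
proof -
  have "(INF s\<in>S. Dist X (w s) (w' s)) \<le>
      Dist (sharp X) (amap H S (Obj X) w a) (amap H S (Obj X) w' a)"
    using compatible_sharp[OF assms(1)] assms(3-) unfolding compatible_def by blast
  also have "\<dots> \<le> Dist Z (f (amap H S (Obj X) w a)) (f (amap H S (Obj X) w' a))"
    using assms by (intro V_functors_le[OF assms(2)]) (simp_all add: H_mem)
  finally show ?thesis .
qed

section \<open>Enriched functoriality of \<open>sharp\<close>\<close>

definition sharp_func :: "(('v, 'u) vcat, 'u \<Rightarrow> 'u, ('v, 'u) vcat, 'u \<Rightarrow> 'u) func" where
  "sharp_func = \<lparr>omap = sharp, amap = (\<lambda>X Y. \<lambda>g\<in>V_functors X Y. amap H (Obj X) (Obj Y) g)\<rparr>"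

text \<open>Composition with \<open>g\<close> sends functions \<open>w\<close>, \<open>w'\<close>
  into \<open>X\<close> to functions into \<open>Y\<close> whose distance is at least as large in
  the order of the quantale; compatibility of \<open>sharp Y\<close> then bounds their images under
  \<open>H\<close>.\<close>

lemma sharp_arr:
  assumes "Obj X \<in> U" "Obj Y \<in> U" "g \<in> V_functors X Y"
  shows "amap H (Obj X) (Obj Y) g \<in> V_functors (sharp X) (sharp Y)"
proof (rule sharp_V_functorsI)
  have g: "g \<in> Obj X \<rightarrow>\<^sub>E Obj Y"
    using assms(3) by (rule V_functors_PiE)
  show "V_category (sharp Y)"
    by (rule V_category_sharp) fact
  show "amap H (Obj X) (Obj Y) g \<in> V_functors (omap H (Obj X)) (sharp Y)"
  proof -
    \<comment> \<open>That \<open>sharp Y\<close> dominates the distance of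
      \<open>omap H (Obj Y)\<close>, expressed as V-functoriality of the identity on
      objects.\<close>
    have id: "(\<lambda>x\<in>Obj (sharp Y). x) \<in> V_functors (omap H (Obj Y)) (sharp Y)"
      by (rule sharp_V_functorsD[OF assms(2) V_functors_id])
    show ?thesis
    proof (rule V_functorsI)
      show "amap H (Obj X) (Obj Y) g \<in> Obj (omap H (Obj X)) \<rightarrow>\<^sub>E Obj (sharp Y)"
        using V_functors_PiE[OF H_arr[OF assms(1,2) g]] by simp
      fix a b assume ab: "a \<in> Obj (omap H (Obj X))" "b \<in> Obj (omap H (Obj X))"
      have m: "amap H (Obj X) (Obj Y) g a \<in> Obj (omap H (Obj Y))"
        "amap H (Obj X) (Obj Y) g b \<in> Obj (omap H (Obj Y))"
        using ab assms g by (auto intro: H_mem)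
      show "Dist (omap H (Obj X)) a b \<le>
          Dist (sharp Y) (amap H (Obj X) (Obj Y) g a) (amap H (Obj X) (Obj Y) g b)"
        using V_functors_le[OF H_arr[OF assms(1,2) g] ab] V_functors_le[OF id m] m
        by (auto intro: order_trans)
    qed
  qed
  fix S w w' a
  assume *: "S \<in> U" "w \<in> S \<rightarrow>\<^sub>E Obj X" "w' \<in> S \<rightarrow>\<^sub>E Obj X" "a \<in> Obj (omap H S)"
  have "(INF s\<in>S. Dist X (w s) (w' s)) \<le> (INF s\<in>S. Dist Y (compose S g w s) (compose S g w' s))"
    using * by (intro INF_superset_mono order_refl) (auto simp: compose_def intro!: V_functors_le[OF assms(3)])
  also have "\<dots> \<le> Dist (sharp Y) (amap H S (Obj Y) (compose S g w) a) (amap H S (Obj Y) (compose S g w') a)"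
  proof (rule compatible_INF[OF compatible_sharp[OF assms(2)]])
    show "compose S g w \<in> S \<rightarrow>\<^sub>E Obj Y" "compose S g w' \<in> S \<rightarrow>\<^sub>E Obj Y"
      using * g by (auto simp: compose_def)
  qed (use * in auto)
  finally show "(INF s\<in>S. Dist X (w s) (w' s)) \<le>
      Dist (sharp Y) (amap H (Obj X) (Obj Y) g (amap H S (Obj X) w a))
        (amap H (Obj X) (Obj Y) g (amap H S (Obj X) w' a))"
    using * assms g by (simp add: H_compose_apply)
qed

lemma enriched_functor_sharp: "enriched_functor (VCat U) (VCat U) sharp_func"
  unfolding enriched_functor_def
proof (intro conjI ballI enriched_category_VCat)
  have PiE: "amap sharp_func X Y
      \<in> V_functors X Y \<rightarrow>\<^sub>E V_functors (sharp X) (sharp Y)" if "Obj X \<in> U" "Obj Y \<in> U" for X Y :: "('v, 'u) vcat"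
    using that by (auto simp: sharp_func_def sharp_arr)
  show "ordinary_functor (VCat U) (VCat U) sharp_func"
    unfolding ordinary_functor_def
  proof (intro conjI ballI)
    show "omap sharp_func \<in> Ob (VCat U) \<rightarrow> Ob (VCat U)"
      by (auto simp: sharp_func_def V_category_sharp H_Obj)
    fix X :: "('v, 'u) vcat" assume X: "X \<in> Ob (VCat U)"
    show "amap sharp_func X X (Id (VCat U) X) = Id (VCat U) (omap sharp_func X)"
      using X by (simp add: sharp_func_def V_functors_id H_id)
    fix Y :: "('v, 'u) vcat" assume Y: "Y \<in> Ob (VCat U)"
    show "amap sharp_func X Y \<in>
        Arr (VCat U) X Y \<rightarrow>\<^sub>E Arr (VCat U) (omap sharp_func X) (omap sharp_func Y)"
      using X Y PiE by (simp add: sharp_func_def)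
    fix Z f g assume "Z \<in> Ob (VCat U)" "f \<in> Arr (VCat U) X Y" "g \<in> Arr (VCat U) Y Z"
    then show "amap sharp_func X Z (Comp (VCat U) X Y Z g f) =
        Comp (VCat U) (omap sharp_func X) (omap sharp_func Y) (omap sharp_func Z)
          (amap sharp_func Y Z g) (amap sharp_func X Y f)"
      using X Y by (simp add: sharp_func_def V_functors_compose H_compose V_functors_PiE)
  qed
  fix X Y :: "('v, 'u) vcat" assume XY: "X \<in> Ob (VCat U)" "Y \<in> Ob (VCat U)"
  show "amap sharp_func X Y \<in> V_functors (Hom (VCat U) X Y)
      (Hom (VCat U) (omap sharp_func X) (omap sharp_func Y))"
  proof (rule V_functorsI, goal_cases)
    case 1
    then show ?case using XY PiE by (simp add: sharp_func_def)
  next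
    case (2 g g')
    then have g: "g \<in> V_functors X Y" "g' \<in> V_functors X Y" by auto
    \<comment> \<open>Compatibility of \<open>sharp Y\<close> at \<open>S = Obj X\<close>, with
      \<open>g\<close> and \<open>g'\<close> themselves as \<open>w\<close> and
      \<open>w'\<close>.\<close>
    have "(INF x\<in>Obj X. Dist Y (g x) (g' x)) \<le>
        (INF a\<in>Obj (omap H (Obj X)). Dist (sharp Y) (amap H (Obj X) (Obj Y) g a) (amap H (Obj X) (Obj Y) g' a))"
      using compatible_sharp[of Y] XY V_functors_PiE[OF g(1)] V_functors_PiE[OF g(2)]
      unfolding compatible_def by (intro INF_greatest) auto
    then show ?case
      using g XY by (simp add: sharp_func_def Dist_internal_hom sharp_arr)
  qed
qed


section \<open>\<open>sharp X\<close> as the colimit of \<open>H\<close> with weight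
  \<open>[D-,X]\<close>\<close>

text \<open>Serves as \<open>\<kappa>\<close> in \<open>kan_colimit_functor\<close>: the
  Yoneda-style correspondence, with V-functors out of the discrete \<open>S\<close> written as plain
  functions.\<close>

definition kan_unit :: "('v, 'u) vcat \<Rightarrow> ('v, 'u) vcat \<Rightarrow> ('u \<Rightarrow> 'u) \<Rightarrow> 'u set \<Rightarrow> ('u \<Rightarrow> 'u) \<Rightarrow> 'u \<Rightarrow> 'u" where
  "kan_unit X Z = (\<lambda>h\<in>V_functors (sharp X) Z. \<lambda>S\<in>U. \<lambda>w\<in>S \<rightarrow>\<^sub>E Obj X.
     compose (Obj (omap H S)) h (amap H S (Obj X) w))"

lemma enriched_functor_D: "enriched_functor (SetCat U) (VCat U) D_func"
proof (rule enriched_functor_discreteI[OF enriched_category_SetCat enriched_category_VCat])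
  show "ordinary_functor (SetCat U) (VCat U) D_func"
    unfolding ordinary_functor_def
    by (auto simp: D_func_def V_category_discrete V_functors_discrete compose_def)
qed simp

text \<open>The naturality squares are evaluated at each \<open>w\<close>: the weight acts by
  precomposition with \<open>f\<close>, the target by precomposition with
  \<open>H f\<close>.\<close>

lemma Obj_kan_hom:
  assumes "V_category X" "Obj X \<in> U" "V_category Z"
  shows "\<alpha> \<in> Obj (nat_hom (op_cat (SetCat U)) (hom_weight (SetCat U) (VCat U) D_func X)
        (hom_weight (SetCat U) (VCat U) H Z)) \<longleftrightarrow>
      \<alpha> \<in> (\<Pi>\<^sub>E S\<in>U. V_functors (internal_hom (discrete S) X) (internal_hom (omap H S) Z)) \<and>
      (\<forall>S\<in>U. \<forall>T\<in>U. \<forall>f\<in>T \<rightarrow>\<^sub>E S. \<forall>w\<in>S \<rightarrow>\<^sub>E Obj X.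
        \<alpha> T (compose T w f) = compose (Obj (omap H T)) (\<alpha> S w) (amap H T S f))"
  (is "?L \<longleftrightarrow> ?P \<and> ?R")
proof -
  have "compose (S \<rightarrow>\<^sub>E Obj X) (\<lambda>h\<in>V_functors (omap H S) Z. compose (Obj (omap H T)) h (amap H T S f)) (\<alpha> S)
       = compose (S \<rightarrow>\<^sub>E Obj X) (\<alpha> T) (\<lambda>h\<in>S \<rightarrow>\<^sub>E Obj X. compose T h f) \<longleftrightarrow>
       (\<forall>w\<in>S \<rightarrow>\<^sub>E Obj X. \<alpha> T (compose T w f) = compose (Obj (omap H T)) (\<alpha> S w) (amap H T S f))"
    if ?P "S \<in> U" for S T f
  proof -
    \<comment> \<open>Precomposition with \<open>H f\<close> is defined on V-functors only, so it
      can be evaluated at \<open>\<alpha> S w\<close> once this is known.\<close>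
    have "\<alpha> S w \<in> V_functors (omap H S) Z" if w: "w \<in> S \<rightarrow>\<^sub>E Obj X" for w
    proof -
      have "\<alpha> S \<in> V_functors (internal_hom (discrete S) X) (internal_hom (omap H S) Z)"
        using \<open>?P\<close> \<open>S \<in> U\<close> by auto
      from V_functors_mem[OF this, of w] show ?thesis
        using w assms(1) by (simp add: V_functors_discrete)
    qed
    then show ?thesis
      unfolding compose_def[of "S \<rightarrow>\<^sub>E Obj X"] fun_eq_iff[of "restrict _ _"] by (auto simp: restrict_def)
  qed
  then show ?thesis
    unfolding Obj_nat_hom
    using assms(1) by (auto simp: hom_weight_def D_func_def V_functors_discrete)
qed

text \<open>V-functoriality in \<open>w\<close> is the compatibility built into
  \<open>sharp X\<close>; naturality in \<open>S\<close> is functoriality of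
  \<open>H\<close>.\<close>

lemma kan_unit_mem:
  assumes "V_category X" "Obj X \<in> U" "V_category Z" "h \<in> V_functors (sharp X) Z"
  shows "kan_unit X Z h \<in> Obj (nat_hom (op_cat (SetCat U)) (hom_weight (SetCat U) (VCat U) D_func X)
        (hom_weight (SetCat U) (VCat U) H Z))"
  unfolding Obj_kan_hom[OF assms(1-3)]
proof (intro conjI ballI)
  have h: "h \<in> V_functors (omap H (Obj X)) Z"
    using assms by (intro sharp_V_functorsD)
  have m: "compose (Obj (omap H S)) h (amap H S (Obj X) w) \<in> V_functors (omap H S) Z"
    if "S \<in> U" "w \<in> S \<rightarrow>\<^sub>E Obj X" for S w
    by (rule V_functors_compose[OF H_arr h]) (use that assms in auto)
  show "kan_unit X Z h \<in> (\<Pi>\<^sub>E S\<in>U. V_functors (internal_hom (discrete S) X) (internal_hom (omap H S) Z))"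
  proof (rule PiE_I)
    fix S assume S: "S \<in> U"
    show "kan_unit X Z h S \<in> V_functors (internal_hom (discrete S) X) (internal_hom (omap H S) Z)"
    proof (rule V_functorsI, goal_cases)
      case 1
      then show ?case using assms S m by (auto simp: kan_unit_def V_functors_discrete)
    next
      case (2 w w')
      then have w: "w \<in> S \<rightarrow>\<^sub>E Obj X" "w' \<in> S \<rightarrow>\<^sub>E Obj X"
        using assms(1) by (auto simp: V_functors_discrete)
      have "(INF s\<in>S. Dist X (w s) (w' s)) \<le> (INF a\<in>Obj (omap H S).
          Dist Z (h (amap H S (Obj X) w a)) (h (amap H S (Obj X) w' a)))"
        by (intro INF_greatest sharp_V_functors_INF assms S w)
      then show ?case
        using 2 w S assms by (simp add: Dist_internal_hom kan_unit_def m) (simp add: compose_def)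
    qed
  qed (use assms in \<open>simp add: kan_unit_def\<close>)
  fix S T f w assume *: "S \<in> U" "T \<in> U" "f \<in> T \<rightarrow>\<^sub>E S" "w \<in> S \<rightarrow>\<^sub>E Obj X"
  have "compose T w f \<in> T \<rightarrow>\<^sub>E Obj X"
    using * by (auto simp: compose_def)
  then show "kan_unit X Z h T (compose T w f) =
      compose (Obj (omap H T)) (kan_unit X Z h S w) (amap H T S f)"
    using * assms by (auto simp: kan_unit_def compose_def[of "Obj _"] H_compose_apply H_mem fun_eq_iff
        restrict_def)
qed

text \<open>Evaluation at the identity of \<open>Obj X\<close> is the candidate inverse; it returns
  \<open>h\<close> because \<open>H\<close> preserves identities.\<close>

lemma kan_unit_id:
  assumes "Obj X \<in> U" "h \<in> V_functors (sharp X) Z"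
  shows "kan_unit X Z h (Obj X) (\<lambda>x\<in>Obj X. x) = h"
  using assms V_functors_ext[OF assms(2)]
  by (auto simp: kan_unit_def H_id compose_def extensional_def fun_eq_iff)

lemma kan_unit_inverse:
  assumes "V_category X" "Obj X \<in> U" "V_category Z"
    and "\<alpha> \<in> Obj (nat_hom (op_cat (SetCat U)) (hom_weight (SetCat U) (VCat U) D_func X)
        (hom_weight (SetCat U) (VCat U) H Z))"
  defines "h \<equiv> \<alpha> (Obj X) (\<lambda>x\<in>Obj X. x)"
  shows "h \<in> V_functors (sharp X) Z" "kan_unit X Z h = \<alpha>"
proof -
  have \<alpha>: "\<alpha> \<in> (\<Pi>\<^sub>E S\<in>U. V_functors (internal_hom (discrete S) X) (internal_hom (omap H S) Z))"
    and nat: "\<And>S T f w. S \<in> U \<Longrightarrow> T \<in> U \<Longrightarrow> f \<in> T \<rightarrow>\<^sub>E S \<Longrightarrow> w \<in> S \<rightarrow>\<^sub>E Obj X \<Longrightarrow>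
        \<alpha> T (compose T w f) = compose (Obj (omap H T)) (\<alpha> S w) (amap H T S f)"
    using assms(4) unfolding Obj_kan_hom[OF assms(1-3)] by auto
  have \<alpha>S: "\<alpha> S \<in> V_functors (internal_hom (discrete S) X) (internal_hom (omap H S) Z)" if "S \<in> U" for S
    using \<alpha> that by auto
  \<comment> \<open>The Yoneda argument: naturality along \<open>w\<close>, applied to the identity
    of \<open>Obj X\<close> as an element of the weight, expresses \<open>\<alpha> S w\<close>
    through \<open>h\<close>.\<close>
  have \<alpha>w: "\<alpha> S w = compose (Obj (omap H S)) h (amap H S (Obj X) w)" if "S \<in> U" "w \<in> S \<rightarrow>\<^sub>E Obj X" for S w
  proof -
    have "compose S (\<lambda>x\<in>Obj X. x) w = w"
      using that by (intro Id_compose[of w S "Obj X"]) (auto simp: PiE_def)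
    then show ?thesis
      using nat[OF assms(2) that(1) that(2), of "\<lambda>x\<in>Obj X. x"] by (simp add: h_def)
  qed
  have \<alpha>m: "\<alpha> S w \<in> V_functors (omap H S) Z" if "S \<in> U" "w \<in> S \<rightarrow>\<^sub>E Obj X" for S w
    using V_functors_mem[OF \<alpha>S[OF that(1)], of w] that assms(1) by (simp add: V_functors_discrete)
  show h: "h \<in> V_functors (sharp X) Z"
  proof (rule sharp_V_functorsI[OF assms(3)])
    show "h \<in> V_functors (omap H (Obj X)) Z"
      unfolding h_def using assms(2) by (intro \<alpha>m) auto
    fix S w w' a
    assume *: "S \<in> U" "w \<in> S \<rightarrow>\<^sub>E Obj X" "w' \<in> S \<rightarrow>\<^sub>E Obj X" "a \<in> Obj (omap H S)"
    then have vf: "w \<in> V_functors (discrete S) X" "w' \<in> V_functors (discrete S) X"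
      using assms(1) by (auto simp: V_functors_discrete)
    \<comment> \<open>V-functoriality of \<open>\<alpha> S\<close>, read at the single object
      \<open>a\<close>, is the condition imposed on V-functors out of
      \<open>sharp X\<close>.\<close>
    have "(INF s\<in>S. Dist X (w s) (w' s)) \<le> (INF a\<in>Obj (omap H S). Dist Z (\<alpha> S w a) (\<alpha> S w' a))"
      using V_functors_le[OF \<alpha>S[OF *(1)], of w w'] vf * by (simp add: Dist_internal_hom \<alpha>m)
    also have "\<dots> \<le> Dist Z (\<alpha> S w a) (\<alpha> S w' a)"
      using *(4) by (rule INF_lower)
    finally show "(INF s\<in>S. Dist X (w s) (w' s)) \<le>
        Dist Z (h (amap H S (Obj X) w a)) (h (amap H S (Obj X) w' a))"
      using * by (simp add: \<alpha>w) (simp add: compose_def)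
  qed
  have "kan_unit X Z h S = \<alpha> S" for S
  proof (cases "S \<in> U")
    case True
    have "kan_unit X Z h S w = \<alpha> S w" for w
    proof (cases "w \<in> S \<rightarrow>\<^sub>E Obj X")
      case True
      then show ?thesis using \<alpha>w \<open>S \<in> U\<close> h by (simp add: kan_unit_def)
    next
      \<comment> \<open>Outside the functions into \<open>Obj X\<close> both sides are
        \<open>undefined\<close>, by extensionality.\<close>
      case False
      then show ?thesis
        using \<open>S \<in> U\<close> h V_functors_ext[OF \<alpha>S[OF \<open>S \<in> U\<close>]] assms(1)
        by (auto simp: kan_unit_def V_functors_discrete extensional_def)
    qed
    then show ?thesis by auto
  next
    case False
    then show ?thesis using \<alpha> h by (auto simp: kan_unit_def PiE_def extensional_def)
  qed
  then show "kan_unit X Z h = \<alpha>" by auto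
qed

text \<open>The infimum over all \<open>S\<close> and \<open>w\<close> is attained at the identity
  of \<open>Obj X\<close>, where \<open>h\<close> and \<open>h'\<close> are compared on every object
  of \<open>sharp X\<close>; any other \<open>w\<close> compares them only on the image of
  \<open>H w\<close>.\<close>

lemma Dist_kan_unit:
  assumes "V_category X" "Obj X \<in> U" "V_category Z"
    and h: "h \<in> V_functors (sharp X) Z" "h' \<in> V_functors (sharp X) Z"
  shows "Dist (nat_hom (op_cat (SetCat U)) (hom_weight (SetCat U) (VCat U) D_func X)
        (hom_weight (SetCat U) (VCat U) H Z)) (kan_unit X Z h) (kan_unit X Z h')
      = Dist (internal_hom (sharp X) Z) h h'" (is "?l = ?r")
proof -
  have hV: "h \<in> V_functors (omap H (Obj X)) Z" "h' \<in> V_functors (omap H (Obj X)) Z"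
    using h assms(2) by (auto intro: sharp_V_functorsD)
  let ?D = "\<lambda>S w. INF a\<in>Obj (omap H S). Dist Z (h (amap H S (Obj X) w a)) (h' (amap H S (Obj X) w a))"
  have D: "Dist (internal_hom (omap H S) Z) (kan_unit X Z h S w) (kan_unit X Z h' S w) = ?D S w"
    if "S \<in> U" "w \<in> S \<rightarrow>\<^sub>E Obj X" for S w
    using that assms V_functors_compose[OF H_arr hV(1)] V_functors_compose[OF H_arr hV(2)]
    by (simp add: kan_unit_def Dist_internal_hom) (simp add: compose_def)
  have "?l = (INF S\<in>U. INF w\<in>S \<rightarrow>\<^sub>E Obj X.
      Dist (internal_hom (omap H S) Z) (kan_unit X Z h S w) (kan_unit X Z h' S w))"
    using assms by (simp add: Dist_nat_hom kan_unit_mem)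
      (simp add: hom_weight_def D_func_def V_functors_discrete)
  also have "\<dots> = (INF S\<in>U. INF w\<in>S \<rightarrow>\<^sub>E Obj X. ?D S w)"
    by (intro INF_cong refl D)
  also have "\<dots> = ?r"
  proof (rule antisym)
    have id: "(\<lambda>x\<in>Obj X. x) \<in> Obj X \<rightarrow>\<^sub>E Obj X" by auto
    have "(INF S\<in>U. INF w\<in>S \<rightarrow>\<^sub>E Obj X. ?D S w) \<le> ?D (Obj X) (\<lambda>x\<in>Obj X. x)"
      by (rule INF_lower2[OF assms(2)], rule INF_lower[OF id])
    also have "\<dots> = ?r"
      using assms by (simp add: H_id Dist_internal_hom)
    finally show "(INF S\<in>U. INF w\<in>S \<rightarrow>\<^sub>E Obj X. ?D S w) \<le> ?r" .
    show "?r \<le> (INF S\<in>U. INF w\<in>S \<rightarrow>\<^sub>E Obj X. ?D S w)"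
      using assms by (auto simp: Dist_internal_hom intro!: INF_greatest INF_lower H_mem)
  qed
  finally show ?thesis .
qed

lemma colimit_iso_kan_unit:
  assumes "V_category X" "Obj X \<in> U"
  shows "colimit_iso (SetCat U) (VCat U) (hom_weight (SetCat U) (VCat U) D_func X) H (sharp X) (kan_unit X)"
  unfolding colimit_iso_def
proof (intro conjI ballI enriched)
  show "enriched_functor (op_cat (SetCat U)) (VCat UNIV) (hom_weight (SetCat U) (VCat U) D_func X)"
    using assms by (intro enriched_functor_hom_weight enriched_functor_D) simp
  show "sharp X \<in> Ob (VCat U)"
    using assms by (simp add: V_category_sharp H_Obj)
  fix Z :: "('v, 'u) vcat" assume "Z \<in> Ob (VCat U)"
  then have Z: "V_category Z" by simp
  have "kan_unit X Z \<in> V_functors (sharp X) Z \<rightarrow>\<^sub>E Obj (nat_hom (op_cat (SetCat U))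
      (hom_weight (SetCat U) (VCat U) D_func X) (hom_weight (SetCat U) (VCat U) H Z))"
    using assms Z kan_unit_mem by (auto simp: kan_unit_def)
  then show "V_iso (Hom (VCat U) (sharp X) Z) (nat_hom (op_cat (SetCat U))
      (hom_weight (SetCat U) (VCat U) D_func X) (hom_weight (SetCat U) (VCat U) H Z)) (kan_unit X Z)"
    using assms Z
    by (intro V_isoI[where \<psi> = "\<lambda>\<alpha>. \<alpha> (Obj X) (\<lambda>x\<in>Obj X. x)"])
      (simp_all add: kan_unit_id kan_unit_inverse Dist_kan_unit)
  fix Z' k h
  assume "Z' \<in> Ob (VCat U)" "k \<in> Arr (VCat U) Z Z'" "h \<in> Arr (VCat U) (sharp X) Z"
  then have k: "k \<in> V_functors Z Z'" and h: "h \<in> V_functors (sharp X) Z" by auto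
  \<comment> \<open>\<open>kan_unit X Z'\<close> is restricted to V-functors, so the composite must
    be known to be one; naturality in \<open>Z\<close> is then associativity of composition.\<close>
  have kh: "compose (Obj (sharp X)) k h \<in> V_functors (sharp X) Z'"
    using V_functors_compose[OF h k] .
  show "kan_unit X Z' (Comp (VCat U) (sharp X) Z Z' k h) =
      (\<lambda>S\<in>Ob (SetCat U). \<lambda>w\<in>Obj (omap (hom_weight (SetCat U) (VCat U) D_func X) S).
        Comp (VCat U) (omap H S) Z Z' k (kan_unit X Z h S w))"
    using h kh assms
    by (auto simp: kan_unit_def hom_weight_def D_func_def V_functors_discrete compose_def H_mem
        fun_eq_iff restrict_def)
qed

section \<open>The Kan extension along the discrete functor\<close>

text \<open>\<open>sharp_func\<close> is itself the functor given by the weighted colimits, so it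
  serves as \<open>K\<close>, and the comparison isomorphism is the identity.\<close>

lemma left_kan_extension_sharp:
  "left_kan_extension (SetCat U) (VCat U) (VCat U) D_func H sharp_func"
proof -
  have "kan_colimit_functor (SetCat U) (VCat U) (VCat U) D_func H sharp_func"
    unfolding kan_colimit_functor_def
  proof (intro conjI enriched_functor_D enriched_functor_sharp exI[of _ kan_unit] ballI)
    fix X :: "('v, 'u) vcat" assume X: "X \<in> Ob (VCat U)"
    then show "colimit_iso (SetCat U) (VCat U) (hom_weight (SetCat U) (VCat U) D_func X) H
        (omap sharp_func X) (kan_unit X)"
      by (simp add: sharp_func_def colimit_iso_kan_unit)
    fix Y g Z h
    assume *: "Y \<in> Ob (VCat U)" "g \<in> Arr (VCat U) X Y" "Z \<in> Ob (VCat U)"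
      "h \<in> Arr (VCat U) (omap sharp_func Y) Z"
    then have g: "g \<in> V_functors X Y" and h: "h \<in> V_functors (sharp Y) Z"
      by (auto simp: sharp_func_def)
    have "compose (Obj (sharp X)) h (amap H (Obj X) (Obj Y) g) \<in> V_functors (sharp X) Z"
      using X * by (intro V_functors_compose[OF sharp_arr[OF _ _ g] h]) auto
    moreover have "compose S g w \<in> S \<rightarrow>\<^sub>E Obj Y" if "w \<in> S \<rightarrow>\<^sub>E Obj X" for S w
      using that V_functors_PiE[OF g] by (auto simp: compose_def)
    \<comment> \<open>Naturality in \<open>X\<close>: both sides send \<open>w\<close> to
      \<open>h\<close> composed with \<open>H g\<close> and \<open>H w\<close>, by functoriality of
      \<open>H\<close>.\<close>
    ultimately show "kan_unit X Z (Comp (VCat U) (omap sharp_func X) (omap sharp_func Y) Z h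
          (amap sharp_func X Y g)) =
        (\<lambda>S\<in>Ob (SetCat U). \<lambda>w\<in>Arr (VCat U) (omap D_func S) X.
          kan_unit Y Z h S (Comp (VCat U) (omap D_func S) X Y g w))"
      using X * g h V_functors_PiE[OF g]
      by (auto simp: kan_unit_def sharp_func_def D_func_def V_functors_discrete compose_def[of "Obj _"]
          H_mem H_compose_apply fun_eq_iff restrict_def)
  qed
  moreover have "natural_iso (VCat U) (VCat U) sharp_func sharp_func (\<lambda>X. \<lambda>a\<in>Obj (sharp X). a)"
  proof -
    have o: "omap sharp_func X = sharp X" for X :: "('v, 'u) vcat" by (simp add: sharp_func_def)
    have V: "ordinary_functor (VCat U) (VCat U) sharp_func"
      using enriched_functor_sharp by (simp add: enriched_functor_def)
    show ?thesis
      unfolding natural_iso_def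
    proof (intro conjI ballI)
      fix X :: "('v, 'u) vcat" assume X: "X \<in> Ob (VCat U)"
      show "(\<lambda>a\<in>Obj (sharp X). a) \<in> Arr (VCat U) (omap sharp_func X) (omap sharp_func X)"
        using V_functors_id[of "sharp X"] by (simp add: o)
      show "\<exists>\<theta>'\<in>Arr (VCat U) (omap sharp_func X) (omap sharp_func X).
           Comp (VCat U) (omap sharp_func X) (omap sharp_func X) (omap sharp_func X) \<theta>' (\<lambda>a\<in>Obj (sharp X). a)
             = Id (VCat U) (omap sharp_func X) \<and>
           Comp (VCat U) (omap sharp_func X) (omap sharp_func X) (omap sharp_func X) (\<lambda>a\<in>Obj (sharp X). a) \<theta>'
             = Id (VCat U) (omap sharp_func X)"
        using V_functors_id[of "sharp X"]
        by (intro bexI[of _ "\<lambda>a\<in>Obj (sharp X). a"]) (auto simp: o compose_def fun_eq_iff)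
      fix Y g assume Y: "Y \<in> Ob (VCat U)" and "g \<in> Arr (VCat U) X Y"
      then have "amap sharp_func X Y g \<in> V_functors (sharp X) (sharp Y)"
        using ordinary_functorD(3)[OF V X Y] by (simp add: o)
      then show "Comp (VCat U) (omap sharp_func X) (omap sharp_func Y) (omap sharp_func Y)
            (\<lambda>a\<in>Obj (sharp Y). a) (amap sharp_func X Y g) =
          Comp (VCat U) (omap sharp_func X) (omap sharp_func X) (omap sharp_func Y)
            (amap sharp_func X Y g) (\<lambda>a\<in>Obj (sharp X). a)"
        using V_functors_mem[of "amap sharp_func X Y g" "sharp X" "sharp Y"]
        by (auto simp: o compose_def fun_eq_iff)
    qed
  qed
  ultimately show ?thesis
    unfolding left_kan_extension_def using enriched_functor_sharp by blast
qed

end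

section \<open>The colimit weighted by N\<close>

lemma V_category_N_ob: "V_category (N_ob a)"
  by (cases a) (auto simp: one_vcat_def two_vcat_def intro!: V_category_mk_vcatI)

lemma N_arr_V_functor: "f \<in> n_arrows b a \<Longrightarrow> N_arr f \<in> V_functors (N_ob a) (N_ob b)"
  by (cases b; cases a)
    (auto simp: one_vcat_def two_vcat_def intro!: V_functorsI split: if_splits)

lemma enriched_functor_N_weight: "enriched_functor (op_cat N_cat) (VCat UNIV) N_weight"
proof (rule enriched_functor_discreteI[OF enriched_category_op[OF enriched_category_N_cat] enriched_category_VCat])
  have [simp]: "NId a \<in> n_arrows a a" for a :: "'v::commutative_quantale n_ob"
    by (cases a) auto
  have comp: "n_comp f g \<in> n_arrows c a"
    "N_arr (n_comp f g) = compose (Obj (N_ob a)) (N_arr g) (N_arr f)"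
    if "f \<in> n_arrows b a" "g \<in> n_arrows c b" for a b c :: "'v::commutative_quantale n_ob" and f g
    using that by (cases a; cases b; cases c;
        auto simp: compose_def one_vcat_def two_vcat_def fun_eq_iff split: if_splits)+
  show "ordinary_functor (op_cat N_cat) (VCat UNIV) (N_weight :: ('v::commutative_quantale n_ob, _, _, _) func)"
    unfolding ordinary_functor_def N_weight_def
    by (auto simp: V_category_N_ob N_arr_V_functor comp)
qed simp

text \<open>The underlying ordinary functor of the weight is represented by \<open>Base\<close>.\<close>

fun N_leg :: "'v n_ob \<Rightarrow> nat \<Rightarrow> 'v n_arr" where
  "N_leg Base i = NId Base"
| "N_leg (Level r) i = Delta i r"

lemma N_leg_arrow: "i \<in> Obj (N_ob a) \<Longrightarrow> N_leg a i \<in> n_arrows a Base"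
  by (cases a) (auto simp: one_vcat_def two_vcat_def)

text \<open>The Yoneda element of the representation is the object \<open>0\<close> of
  \<open>one_vcat\<close>: each \<open>i\<close> is the image of \<open>0\<close> under its own
  leg.\<close>

lemma N_arr_leg: "i \<in> Obj (N_ob a) \<Longrightarrow> N_arr (N_leg a i) 0 = i"
  by (cases a) (auto simp: one_vcat_def)

text \<open>Naturality of the representation: the contravariant action of the weight corresponds to
  composition in \<open>N_cat\<close>.\<close>

lemma N_leg_comp:
  "f \<in> n_arrows b a \<Longrightarrow> i \<in> Obj (N_ob a) \<Longrightarrow> N_leg b (N_arr f i) = n_comp (N_leg a i) f"
  by (cases b; cases a) (auto simp: one_vcat_def two_vcat_def split: if_splits)

section \<open>The diagram \<open>H F_X\<close> and its legs\<close>

locale set_functor_pair = set_functor U H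
  for U :: "'u set set"
    and H :: "('u set, 'u \<Rightarrow> 'u, ('v::commutative_quantale, 'u) vcat, 'u \<Rightarrow> 'u) func" +
  fixes pair :: "'u \<times> 'u \<Rightarrow> 'u"
  assumes universe: "set_universe U pair"
begin

lemma inv_pair [simp]: "inv pair (pair p) = p"
  using universe by (simp add: set_universe_def)

text \<open>Up to the coding by \<open>pair\<close>, \<open>X_r\<close> is a subset of a binary
  product, so both closure properties of the universe apply.\<close>

lemma F_ob_mem: "Obj X \<in> U \<Longrightarrow> F_ob pair X a \<in> U"
proof (cases a)
  case (Level r)
  assume X: "Obj X \<in> U"
  then have "pair ` (Obj X \<times> Obj X) \<in> U" "\<And>S T. S \<in> U \<Longrightarrow> T \<subseteq> S \<Longrightarrow> T \<in> U"
    using universe by (auto simp: set_universe_def)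
  moreover have "F_ob pair X a \<subseteq> pair ` (Obj X \<times> Obj X)"
    using Level by auto
  ultimately show ?thesis by blast
qed simp

lemma F_arr_mem: "f \<in> n_arrows a b \<Longrightarrow> F_arr pair X f \<in> F_ob pair X a \<rightarrow>\<^sub>E F_ob pair X b"
  by (cases a; cases b) (auto split: if_splits)

lemma ordinary_functor_F:
  fixes X :: "('v, 'u) vcat"
  assumes "Obj X \<in> U"
  shows "ordinary_functor N_cat (SetCat U) (F_func pair X)"
proof -
  have [simp]: "NId a \<in> n_arrows a a" for a :: "'v n_ob"
    by (cases a) auto
  have comp: "n_comp g f \<in> n_arrows a c"
    "F_arr pair X (n_comp g f) = compose (F_ob pair X a) (F_arr pair X g) (F_arr pair X f)"
    if "f \<in> n_arrows a b" "g \<in> n_arrows b c" for a b c :: "'v n_ob" and f g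
    using that by (cases a; cases b; cases c;
        auto simp: compose_def fun_eq_iff split: if_splits)+
  show ?thesis
    unfolding ordinary_functor_def F_func_def
    using assms by (simp add: F_ob_mem comp F_arr_mem)
qed

lemma HF_simps:
  "omap (comp_func N_cat H (F_func pair X)) a = omap H (F_ob pair X a)"
  "f \<in> n_arrows a b \<Longrightarrow> amap (comp_func N_cat H (F_func pair X)) a b f =
    amap H (F_ob pair X a) (F_ob pair X b) (F_arr pair X f)"
  by (simp_all add: comp_func_def F_func_def)

lemma enriched_functor_HF:
  assumes "Obj X \<in> U"
  shows "enriched_functor N_cat (VCat U) (comp_func N_cat H (F_func pair X))"
  by (rule enriched_functor_discreteI[OF enriched_category_N_cat enriched_category_VCat
        ordinary_functor_comp[OF enriched_category_N_cat ordinary_functor_F[OF assms] ordinary]])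
    simp

text \<open>The image under \<open>H\<close> of the first or second projection of
  \<open>X_r\<close>, and at \<open>Base\<close> of the identity.\<close>

definition leg :: "('v, 'u) vcat \<Rightarrow> 'v n_ob \<Rightarrow> nat \<Rightarrow> 'u \<Rightarrow> 'u" where
  "leg X a i = amap H (F_ob pair X a) (Obj X) (F_arr pair X (N_leg a i))"

text \<open>The analogue of \<open>kan_unit\<close>, with the projections
  \<open>F_arr pair X (N_leg a i)\<close> in place of arbitrary \<open>w\<close>.\<close>

definition colimit_unit ::
    "('v, 'u) vcat \<Rightarrow> ('v, 'u) vcat \<Rightarrow> ('u \<Rightarrow> 'u) \<Rightarrow> 'v n_ob \<Rightarrow> nat \<Rightarrow> 'u \<Rightarrow> 'u" where
  "colimit_unit X Z = (\<lambda>h\<in>V_functors (sharp X) Z. \<lambda>a. \<lambda>i\<in>Obj (N_ob a).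
     compose (Obj (omap H (F_ob pair X a))) h (leg X a i))"

abbreviation colimit_hom where
  "colimit_hom X Z \<equiv> nat_hom (op_cat N_cat) N_weight
     (hom_weight N_cat (VCat U) (comp_func N_cat H (F_func pair X)) Z)"

lemma F_leg_mem: "i \<in> Obj (N_ob a) \<Longrightarrow> F_arr pair X (N_leg a i) \<in> F_ob pair X a \<rightarrow>\<^sub>E Obj X"
  using F_arr_mem[OF N_leg_arrow] by auto

lemma leg_V_functor:
  "Obj X \<in> U \<Longrightarrow> i \<in> Obj (N_ob a) \<Longrightarrow> leg X a i \<in> V_functors (omap H (F_ob pair X a)) (omap H (Obj X))"
  unfolding leg_def by (intro H_arr F_ob_mem F_leg_mem)

lemma leg_Base: "Obj X \<in> U \<Longrightarrow> leg X Base i = (\<lambda>x\<in>Obj (omap H (Obj X)). x)"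
  by (simp add: leg_def H_id)

text \<open>The leg of \<open>N_arr f i\<close> is that of \<open>i\<close> composed with
  \<open>f\<close> in \<open>N_cat\<close>, and \<open>F_func pair X\<close> and \<open>H\<close>
  preserve this composite.\<close>

lemma leg_N_arr:
  assumes "Obj X \<in> U" "f \<in> n_arrows b a" "i \<in> Obj (N_ob a)"
  shows "leg X b (N_arr f i) = compose (Obj (omap H (F_ob pair X b))) (leg X a i)
    (amap H (F_ob pair X b) (F_ob pair X a) (F_arr pair X f))"
proof -
  have "F_arr pair X (n_comp (N_leg a i) f) =
      compose (F_ob pair X b) (F_arr pair X (N_leg a i)) (F_arr pair X f)"
    using ordinary_functorD(5)[OF ordinary_functor_F[OF assms(1)], of b a Base f "N_leg a i"]
      assms N_leg_arrow[OF assms(3)] N_leg_arrow[OF V_functors_mem[OF N_arr_V_functor[OF assms(2)] assms(3)]]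
    by (simp add: F_func_def N_leg_comp)
  then show ?thesis
    using assms by (simp add: leg_def N_leg_comp H_compose F_ob_mem F_arr_mem F_leg_mem)
qed

section \<open>\<open>sharp X\<close> as the colimit of \<open>H F_X\<close> weighted by N\<close>

lemma Obj_colimit_hom:
  assumes "Obj X \<in> U" "V_category Z"
  shows "\<alpha> \<in> Obj (colimit_hom X Z) \<longleftrightarrow>
    (\<forall>a. \<alpha> a \<in> V_functors (N_ob a) (internal_hom (omap H (F_ob pair X a)) Z)) \<and>
    (\<forall>a b. \<forall>f\<in>n_arrows b a. \<forall>i\<in>Obj (N_ob a).
      \<alpha> b (N_arr f i) = compose (Obj (omap H (F_ob pair X b))) (\<alpha> a i)
        (amap H (F_ob pair X b) (F_ob pair X a) (F_arr pair X f)))"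
proof -
  have key: "compose (Obj (N_ob a)) (\<lambda>h\<in>V_functors (omap H (F_ob pair X a)) Z.
        compose (Obj (omap H (F_ob pair X b))) h (amap H (F_ob pair X b) (F_ob pair X a) (F_arr pair X f))) (\<alpha> a)
      = compose (Obj (N_ob a)) (\<alpha> b) (N_arr f) \<longleftrightarrow>
      (\<forall>i\<in>Obj (N_ob a). \<alpha> b (N_arr f i) = compose (Obj (omap H (F_ob pair X b))) (\<alpha> a i)
        (amap H (F_ob pair X b) (F_ob pair X a) (F_arr pair X f)))"
    if "\<alpha> a \<in> V_functors (N_ob a) (internal_hom (omap H (F_ob pair X a)) Z)" for a b f
    using V_functors_mem[OF that]
    unfolding compose_def[of "Obj (N_ob a)"] fun_eq_iff[of "restrict _ _"] by (auto simp: restrict_def)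
  then show ?thesis
    unfolding Obj_nat_hom
    by (auto simp: N_weight_def hom_weight_def HF_simps PiE_UNIV_domain Pi_iff key)
qed

lemma colimit_unit_mem:
  assumes X: "Obj X \<in> U" and Z: "V_category Z" and h: "h \<in> V_functors (sharp X) Z"
  shows "colimit_unit X Z h \<in> Obj (colimit_hom X Z)"
  unfolding Obj_colimit_hom[OF X Z]
proof (intro conjI allI ballI)
  have hV: "h \<in> V_functors (omap H (Obj X)) Z"
    using X h by (rule sharp_V_functorsD)
  have m: "compose (Obj (omap H (F_ob pair X a))) h (leg X a i) \<in> V_functors (omap H (F_ob pair X a)) Z"
    if "i \<in> Obj (N_ob a)" for a i
    using that X by (intro V_functors_compose[OF leg_V_functor hV])
  fix a
  show "colimit_unit X Z h a \<in> V_functors (N_ob a) (internal_hom (omap H (F_ob pair X a)) Z)"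
  proof (rule V_functorsI, goal_cases)
    case 1
    then show ?case using h m by (auto simp: colimit_unit_def)
  next
    case (2 i j)
    have "Dist (N_ob a) i j \<le> Dist Z (h (leg X a i z)) (h (leg X a j z))"
      if z: "z \<in> Obj (omap H (F_ob pair X a))" for z
    \<comment> \<open>Three distances occur in \<open>N_ob a\<close>: the unit on the diagonal,
      \<open>r\<close> from \<open>0\<close> to \<open>1\<close> in \<open>two_vcat r\<close>, and
      \<open>bot\<close> from \<open>1\<close> to \<open>0\<close>. Only the second draws on
      compatibility.\<close>
    proof (cases "i = j")
      case True
      then show ?thesis
        using 2 V_functors_le[OF hV] V_functors_mem[OF leg_V_functor[OF X 2(1)] z]
          V_category_refl[OF Z] V_functors_mem[OF hV]
        by (cases a) (auto simp: one_vcat_def two_vcat_def)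
    next
      case False
      show ?thesis
      proof (cases "i = 0 \<and> a \<noteq> Base")
        case True
        then obtain r where a: "a = Level r" by (cases a) auto
        have ij: "i = 0" "j = 1" using True False 2(2) a by (auto simp: two_vcat_def)
        \<comment> \<open>Every \<open>s\<close> in \<open>X_r\<close> codes a pair at distance at
          least \<open>r\<close>, and the two legs are its projections.\<close>
        have "r \<le> (INF s\<in>F_ob pair X a. Dist X (F_arr pair X (N_leg a i) s) (F_arr pair X (N_leg a j) s))"
          unfolding a ij by (rule INF_greatest) auto
        also have "\<dots> \<le> Dist Z (h (leg X a i z)) (h (leg X a j z))"
          unfolding leg_def using 2 z
          by (intro sharp_V_functors_INF[OF X h] F_ob_mem F_leg_mem X)
        finally show ?thesis by (simp add: a ij two_vcat_def)
      next
        \<comment> \<open>\<open>Base\<close> carries a single object, so only the distance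
          \<open>bot\<close> from \<open>1\<close> to \<open>0\<close> remains.\<close>
        case F: False
        then show ?thesis
          using False 2 by (cases a) (auto simp: one_vcat_def two_vcat_def)
      qed
    qed
    then have "Dist (N_ob a) i j \<le>
        (INF z\<in>Obj (omap H (F_ob pair X a)). Dist Z (h (leg X a i z)) (h (leg X a j z)))"
      by (intro INF_greatest)
    then show ?case
      using 2 h by (simp add: colimit_unit_def Dist_internal_hom m) (simp add: compose_def)
  qed
next
  fix a b :: "'v n_ob" and f i assume *: "f \<in> n_arrows b a" "i \<in> Obj (N_ob a)"
  have "amap H (F_ob pair X b) (F_ob pair X a) (F_arr pair X f) z \<in> Obj (omap H (F_ob pair X a))"
    if "z \<in> Obj (omap H (F_ob pair X b))" for z
    using that * X by (intro H_mem F_ob_mem F_arr_mem)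
  then show "colimit_unit X Z h b (N_arr f i) = compose (Obj (omap H (F_ob pair X b)))
      (colimit_unit X Z h a i) (amap H (F_ob pair X b) (F_ob pair X a) (F_arr pair X f))"
    using * X h V_functors_mem[OF N_arr_V_functor[OF *(1)] *(2)]
    by (auto simp: colimit_unit_def leg_N_arr compose_def fun_eq_iff)
qed

text \<open>The leg at \<open>Base\<close> is the identity, so evaluation there inverts
  \<open>colimit_unit\<close> on one side.\<close>

lemma colimit_unit_Base:
  assumes "Obj X \<in> U" "h \<in> V_functors (sharp X) Z"
  shows "colimit_unit X Z h Base 0 = h"
  using assms V_functors_ext[OF assms(2)]
  by (auto simp: colimit_unit_def leg_Base one_vcat_def compose_def extensional_def fun_eq_iff)

lemma colimit_unit_inverse:
  assumes X: "Obj X \<in> U" and Z: "V_category Z" and \<alpha>: "\<alpha> \<in> Obj (colimit_hom X Z)"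
  shows "\<alpha> Base 0 \<in> V_functors (sharp X) Z" "colimit_unit X Z (\<alpha> Base 0) = \<alpha>"
proof -
  have \<alpha>V: "\<alpha> a \<in> V_functors (N_ob a) (internal_hom (omap H (F_ob pair X a)) Z)" for a
    using \<alpha> unfolding Obj_colimit_hom[OF X Z] by blast
  \<comment> \<open>Naturality along the leg from \<open>a\<close> to \<open>Base\<close>: since
    \<open>i\<close> is the image of \<open>0\<close> under it, the component at \<open>Base\<close>
    determines all of \<open>\<alpha>\<close>.\<close>
  have \<alpha>leg: "\<alpha> a i = compose (Obj (omap H (F_ob pair X a))) (\<alpha> Base 0) (leg X a i)"
    if "i \<in> Obj (N_ob a)" for a i
  proof -
    have "\<alpha> a (N_arr (N_leg a i) 0) = compose (Obj (omap H (F_ob pair X a))) (\<alpha> Base 0)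
        (amap H (F_ob pair X a) (F_ob pair X Base) (F_arr pair X (N_leg a i)))"
      using \<alpha> N_leg_arrow[OF that] unfolding Obj_colimit_hom[OF X Z] by (auto simp: one_vcat_def)
    then show ?thesis
      using that by (simp add: N_arr_leg leg_def)
  qed
  have \<alpha>m: "\<alpha> a i \<in> V_functors (omap H (F_ob pair X a)) Z" if "i \<in> Obj (N_ob a)" for a i
    using V_functors_mem[OF \<alpha>V that] by simp
  show h: "\<alpha> Base 0 \<in> V_functors (sharp X) Z"
  proof (rule sharp_V_functorsI[OF Z])
    show "\<alpha> Base 0 \<in> V_functors (omap H (Obj X)) Z"
      using \<alpha>m[of 0 Base] by (simp add: one_vcat_def)
    fix S w w' a
    assume *: "S \<in> U" "w \<in> S \<rightarrow>\<^sub>E Obj X" "w' \<in> S \<rightarrow>\<^sub>E Obj X" "a \<in> Obj (omap H S)"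
    text \<open>The pair \<open>(w, w')\<close> factors through $X_r$ for \<open>r\<close> the distance of \<open>w\<close> and \<open>w'\<close>.\<close>
    define r where "r = (INF s\<in>S. Dist X (w s) (w' s))"
    define p where "p = (\<lambda>s\<in>S. pair (w s, w' s))"
    have p: "p \<in> S \<rightarrow>\<^sub>E F_ob pair X (Level r)"
      using * by (auto simp: p_def r_def intro!: image_eqI INF_lower)
    have i: "0 \<in> Obj (N_ob (Level r))" "1 \<in> Obj (N_ob (Level r))"
      by (auto simp: two_vcat_def)
    \<comment> \<open>The two projections of \<open>X_r\<close> undo the pairing
      \<open>p\<close>.\<close>
    have w: "w = compose S (F_arr pair X (N_leg (Level r) 0)) p"
      "w' = compose S (F_arr pair X (N_leg (Level r) 1)) p"
      using * PiE_mem[OF p] by (auto simp: compose_def p_def fun_eq_iff PiE_iff extensional_def)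
    define b where "b = amap H S (F_ob pair X (Level r)) p a"
    have b: "b \<in> Obj (omap H (F_ob pair X (Level r)))"
      unfolding b_def by (intro H_mem F_ob_mem X * p)
    \<comment> \<open>Functoriality of \<open>H\<close> turns the two images of \<open>a\<close>
      into the values of the two legs at the common object \<open>b\<close>.\<close>
    have Hw: "amap H S (Obj X) w a = leg X (Level r) 0 b" "amap H S (Obj X) w' a = leg X (Level r) 1 b"
      unfolding leg_def b_def w by (intro H_compose_apply F_ob_mem X * p F_leg_mem i)+
    \<comment> \<open>The distance from \<open>0\<close> to \<open>1\<close> in
      \<open>two_vcat r\<close> is \<open>r\<close>, so V-functoriality of \<open>\<alpha>\<close>
      at this level yields the required bound.\<close>
    have "r = Dist (N_ob (Level r)) 0 1"
      by (simp add: two_vcat_def)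
    also have "\<dots> \<le> Dist (internal_hom (omap H (F_ob pair X (Level r))) Z) (\<alpha> (Level r) 0) (\<alpha> (Level r) 1)"
      by (rule V_functors_le[OF \<alpha>V i])
    also have "\<dots> = (INF b\<in>Obj (omap H (F_ob pair X (Level r))). Dist Z (\<alpha> (Level r) 0 b) (\<alpha> (Level r) 1 b))"
      by (rule Dist_internal_hom[OF \<alpha>m[OF i(1)] \<alpha>m[OF i(2)]])
    also have "\<dots> \<le> Dist Z (\<alpha> (Level r) 0 b) (\<alpha> (Level r) 1 b)"
      by (rule INF_lower[OF b])
    also have "\<dots> = Dist Z (\<alpha> Base 0 (amap H S (Obj X) w a)) (\<alpha> Base 0 (amap H S (Obj X) w' a))"
      unfolding Hw \<alpha>leg[OF i(1)] \<alpha>leg[OF i(2)] using b by (simp add: compose_def)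
    finally show "(INF s\<in>S. Dist X (w s) (w' s)) \<le>
        Dist Z (\<alpha> Base 0 (amap H S (Obj X) w a)) (\<alpha> Base 0 (amap H S (Obj X) w' a))"
      unfolding r_def .
  qed
  have "colimit_unit X Z (\<alpha> Base 0) a i = \<alpha> a i" for a i
  proof (cases "i \<in> Obj (N_ob a)")
    case True
    then show ?thesis using h by (simp add: colimit_unit_def flip: \<alpha>leg)
  next
    case False
    then show ?thesis
      using h V_functors_ext[OF \<alpha>V] by (simp add: colimit_unit_def extensional_def)
  qed
  then show "colimit_unit X Z (\<alpha> Base 0) = \<alpha>" by auto
qed

text \<open>The infimum is attained at \<open>Base\<close>, whose leg is the identity; a leg at
  level \<open>r\<close> compares \<open>h\<close> and \<open>h'\<close> only on its image.\<close>

lemma Dist_colimit_unit: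
  assumes X: "Obj X \<in> U" and Z: "V_category Z"
    and h: "h \<in> V_functors (sharp X) Z" "h' \<in> V_functors (sharp X) Z"
  shows "Dist (colimit_hom X Z) (colimit_unit X Z h) (colimit_unit X Z h')
      = Dist (internal_hom (sharp X) Z) h h'" (is "?l = ?r")
proof -
  have hV: "h \<in> V_functors (omap H (Obj X)) Z" "h' \<in> V_functors (omap H (Obj X)) Z"
    using h X by (auto intro: sharp_V_functorsD)
  let ?D = "\<lambda>a i. INF z\<in>Obj (omap H (F_ob pair X a)). Dist Z (h (leg X a i z)) (h' (leg X a i z))"
  have D: "Dist (internal_hom (omap H (F_ob pair X a)) Z) (colimit_unit X Z h a i) (colimit_unit X Z h' a i)
      = ?D a i" if "i \<in> Obj (N_ob a)" for a i
    using that h V_functors_compose[OF leg_V_functor[OF X that] hV(1)]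
      V_functors_compose[OF leg_V_functor[OF X that] hV(2)]
    by (simp add: colimit_unit_def Dist_internal_hom) (simp add: compose_def)
  have "?l = (INF a. INF i\<in>Obj (N_ob a).
      Dist (internal_hom (omap H (F_ob pair X a)) Z) (colimit_unit X Z h a i) (colimit_unit X Z h' a i))"
    using X Z h by (simp add: Dist_nat_hom colimit_unit_mem)
      (simp add: hom_weight_def N_weight_def HF_simps)
  also have "\<dots> = (INF a. INF i\<in>Obj (N_ob a). ?D a i)"
    by (intro INF_cong refl D)
  also have "\<dots> = ?r"
  proof (rule antisym)
    have 0: "0 \<in> Obj (N_ob Base)" by (simp add: one_vcat_def)
    have "(INF a. INF i\<in>Obj (N_ob a). ?D a i) \<le> ?D Base 0"
      by (rule INF_lower2[OF UNIV_I], rule INF_lower[OF 0])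
    also have "\<dots> = ?r"
      using X h by (simp add: leg_Base Dist_internal_hom)
    finally show "(INF a. INF i\<in>Obj (N_ob a). ?D a i) \<le> ?r" .
    show "?r \<le> (INF a. INF i\<in>Obj (N_ob a). ?D a i)"
      using h V_functors_mem[OF leg_V_functor[OF X]]
      by (auto simp: Dist_internal_hom intro!: INF_greatest INF_lower)
  qed
  finally show ?thesis .
qed

text \<open>Although \<open>N\<close> tests only the sets \<open>X_r\<close>, it yields the same
  \<open>sharp X\<close>, because all pairs of functions factor through them. The inverse of
  \<open>colimit_unit X Z\<close> is evaluation at \<open>Base\<close> and \<open>0\<close>.\<close>

lemma weighted_colimit_sharp:
  assumes "X \<in> Ob (VCat U)"
  shows "weighted_colimit N_cat (VCat U) N_weight (comp_func N_cat H (F_func pair X)) (sharp X)"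
  unfolding weighted_colimit_def colimit_iso_def
proof (intro exI[of _ "colimit_unit X"] conjI ballI enriched_functor_N_weight)
  have X: "Obj X \<in> U" using assms by simp
  show "enriched_functor N_cat (VCat U) (comp_func N_cat H (F_func pair X))"
    using X by (rule enriched_functor_HF)
  show "sharp X \<in> Ob (VCat U)"
    using X by (simp add: V_category_sharp H_Obj)
  fix Z :: "('v, 'u) vcat" assume "Z \<in> Ob (VCat U)"
  then have Z: "V_category Z" by simp
  have "colimit_unit X Z \<in> V_functors (sharp X) Z \<rightarrow>\<^sub>E Obj (colimit_hom X Z)"
    using colimit_unit_mem[OF X Z] by (auto simp: colimit_unit_def)
  then show "V_iso (Hom (VCat U) (sharp X) Z) (colimit_hom X Z) (colimit_unit X Z)"
    using X Z
    by (intro V_isoI[where \<psi> = "\<lambda>\<alpha>. \<alpha> Base 0"])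
      (simp_all add: colimit_unit_Base colimit_unit_inverse Dist_colimit_unit)
  fix Z' k h
  assume "Z' \<in> Ob (VCat U)" "k \<in> Arr (VCat U) Z Z'" "h \<in> Arr (VCat U) (sharp X) Z"
  then have k: "k \<in> V_functors Z Z'" and h: "h \<in> V_functors (sharp X) Z" by auto
  have "compose (Obj (omap H (Obj X))) k h \<in> V_functors (sharp X) Z'"
    using V_functors_compose[OF h k] by simp
  then show "colimit_unit X Z' (Comp (VCat U) (sharp X) Z Z' k h) =
      (\<lambda>a\<in>Ob N_cat. \<lambda>w\<in>Obj (omap N_weight a).
        Comp (VCat U) (omap (comp_func N_cat H (F_func pair X)) a) Z Z' k (colimit_unit X Z h a w))"
    using h V_functors_mem[OF leg_V_functor[OF X]]
    by (auto simp: colimit_unit_def N_weight_def HF_simps compose_def fun_eq_iff)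
qed

end

section \<open>The Kan extension and its pointwise formula combined\<close>

theorem theorem3p8:
  fixes U :: "'u set set"
    and pair :: "'u \<times> 'u \<Rightarrow> 'u"
    and H :: "('u set, 'u \<Rightarrow> 'u, ('v::nontrivial_commutative_quantale, 'u) vcat, 'u \<Rightarrow> 'u) func"
  assumes "set_universe U pair"
    and "ordinary_functor (SetCat U :: ('u set, 'u \<Rightarrow> 'u, 'v) ecat) (VCat U) H"
  shows "\<exists>Hs :: (('v, 'u) vcat, 'u \<Rightarrow> 'u, ('v, 'u) vcat, 'u \<Rightarrow> 'u) func.
    left_kan_extension (SetCat U) (VCat U) (VCat U) D_func H Hs \<and>
    (\<forall>X\<in>Ob (VCat U).
       weighted_colimit N_cat (VCat U) N_weight (comp_func N_cat H (F_func pair X)) (omap Hs X))"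
proof -
  interpret set_functor_pair U H pair
    by unfold_locales (use assms in auto)
  have "omap sharp_func X = sharp X" for X
    by (simp add: sharp_func_def)
  \<comment> \<open>The one functor \<open>sharp_func\<close> satisfies both universal properties,
    so no comparison of the two colimits is required.\<close>
  then show ?thesis
    using left_kan_extension_sharp weighted_colimit_sharp by (intro exI[of _ sharp_func]) simp
qed

end
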